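(* Let $\mathscr{K}$ be an essentially small idempotent-complete tt-category which is the homotopy category of a symmetric monoidal stable $\infty$-category. Suppose that $\mathscr{K}$ is connective and unigenic. If $R_{\mathscr{K}}=\mathrm{End}_{\mathscr{K}}(\mathbb{1})$ is a local ring then $\mathscr{K}$ is a local tt-category.
   Context: A tt-category is a triangulated category with a compatible symmetric monoidal structure $(\otimes,\mathbb{1})$ (with $\otimes$ exact in each variable). An essentially small tt-category $\mathscr{K}$ is unigenic if $\mathscr{K}=\mathrm{thick}\langle\mathbb{1}\rangle$, the smallest thick subcategory containing $\mathbb{1}$. It is connective if $\mathrm{Hom}_{\mathscr{K}}(\mathbb{1},\Sigma^{-i}\mathbb{1})=0$ for all $i<0$. A tt-category $\mathscr{K}$ is local if its Balmer spectrum $\mathrm{Spc}(\mathscr{K})$ (the space of prime thick tensor-ideals with basis of closed sets $\mathrm{supp}(a)=\{\mathscr{P}: a\notin\mathscr{P}\}$) is a local space, i.e. has a unique closed point; for $\mathscr{K}$ rigid this is equivalent to $\mathscr{K}\neq0$ and: $a\otimes b=0$ implies $a=0$ or $b=0$. *)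

theory Defs
  imports
    "HOL-Algebra.Ideal"
    "HOL-Analysis.Abstract_Topology"
    "HOL-Library.Product_Order"
begin

section \<open>Tensor-triangulated categories\<close>

text \<open>The objects and the arrows of a category are subsets of HOL types, so every category below is
  small; up to equivalence this is the same as being essentially small.\<close>

record ('o, 'm) cat =
  ob :: "'o set"
  arr :: "'m set"
  dm :: "'m \<Rightarrow> 'o"
  cd :: "'m \<Rightarrow> 'o"
  idn :: "'o \<Rightarrow> 'm"
  cmp :: "'m \<Rightarrow> 'm \<Rightarrow> 'm"  (infixl "\<cdot>\<index>" 70)

definition homs :: "('o, 'm, 'z) cat_scheme \<Rightarrow> 'o \<Rightarrow> 'o \<Rightarrow> 'm set" where
  "homs C X Y = {f \<in> arr C. dm C f = X \<and> cd C f = Y}"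

locale category =
  fixes C :: "('o, 'm, 'z) cat_scheme" (structure)
  assumes dm_ob: "f \<in> arr C \<Longrightarrow> dm C f \<in> ob C"
    and cd_ob: "f \<in> arr C \<Longrightarrow> cd C f \<in> ob C"
    and idn_homs: "X \<in> ob C \<Longrightarrow> idn C X \<in> homs C X X"
    and cmp_homs: "\<lbrakk>f \<in> homs C X Y; g \<in> homs C Y Z\<rbrakk> \<Longrightarrow> g \<cdot> f \<in> homs C X Z"
    and cmp_idn: "f \<in> homs C X Y \<Longrightarrow> f \<cdot> idn C X = f"
    and idn_cmp: "f \<in> homs C X Y \<Longrightarrow> idn C Y \<cdot> f = f"
    and cmp_assoc: "\<lbrakk>f \<in> homs C W X; g \<in> homs C X Y; h \<in> homs C Y Z\<rbrakk>
      \<Longrightarrow> (h \<cdot> g) \<cdot> f = h \<cdot> (g \<cdot> f)"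

definition iso_arr :: "('o, 'm, 'z) cat_scheme \<Rightarrow> 'm \<Rightarrow> bool" where
  "iso_arr C f \<longleftrightarrow> f \<in> arr C \<and> (\<exists>g \<in> homs C (cd C f) (dm C f).
     g \<cdot>\<^bsub>C\<^esub> f = idn C (dm C f) \<and> f \<cdot>\<^bsub>C\<^esub> g = idn C (cd C f))"

definition endofunctor :: "('o, 'm, 'z) cat_scheme \<Rightarrow> ('o \<Rightarrow> 'o) \<Rightarrow> ('m \<Rightarrow> 'm) \<Rightarrow> bool" where
  "endofunctor C Fo Fa \<longleftrightarrow>
     (\<forall>X \<in> ob C. Fo X \<in> ob C \<and> Fa (idn C X) = idn C (Fo X)) \<and>
     (\<forall>X Y. \<forall>f \<in> homs C X Y. Fa f \<in> homs C (Fo X) (Fo Y)) \<and>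
     (\<forall>X Y Z. \<forall>f \<in> homs C X Y. \<forall>g \<in> homs C Y Z. Fa (g \<cdot>\<^bsub>C\<^esub> f) = Fa g \<cdot>\<^bsub>C\<^esub> Fa f)"

definition autoequivalence :: "('o, 'm, 'z) cat_scheme \<Rightarrow> ('o \<Rightarrow> 'o) \<Rightarrow> ('m \<Rightarrow> 'm) \<Rightarrow> bool" where
  "autoequivalence C Fo Fa \<longleftrightarrow> endofunctor C Fo Fa \<and>
     (\<forall>X \<in> ob C. \<forall>Y \<in> ob C. bij_betw Fa (homs C X Y) (homs C (Fo X) (Fo Y))) \<and>
     (\<forall>Y \<in> ob C. \<exists>X \<in> ob C. \<exists>f \<in> homs C (Fo X) Y. iso_arr C f)"

definition idempotent_complete :: "('o, 'm, 'z) cat_scheme \<Rightarrow> bool" where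
  "idempotent_complete C \<longleftrightarrow> (\<forall>X \<in> ob C. \<forall>e \<in> homs C X X. e \<cdot>\<^bsub>C\<^esub> e = e \<longrightarrow>
     (\<exists>Y \<in> ob C. \<exists>r \<in> homs C X Y. \<exists>s \<in> homs C Y X.
        s \<cdot>\<^bsub>C\<^esub> r = e \<and> r \<cdot>\<^bsub>C\<^esub> s = idn C Y))"


subsection \<open>Triangulated categories\<close>

record ('o, 'm) tri_cat = "('o, 'm) cat" +
  plus :: "'m \<Rightarrow> 'm \<Rightarrow> 'm"
  nul :: "'o \<Rightarrow> 'o \<Rightarrow> 'm"
  suspO :: "'o \<Rightarrow> 'o"
  suspA :: "'m \<Rightarrow> 'm"
  dist :: "('m \<times> 'm \<times> 'm) set"

definition hom_group :: "('o, 'm, 'z) tri_cat_scheme \<Rightarrow> 'o \<Rightarrow> 'o \<Rightarrow> 'm monoid" where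
  "hom_group K X Y = \<lparr>carrier = homs K X Y, mult = plus K, one = nul K X Y\<rparr>"

definition neg :: "('o, 'm, 'z) tri_cat_scheme \<Rightarrow> 'm \<Rightarrow> 'm" where
  "neg K f = inv\<^bsub>hom_group K (dm K f) (cd K f)\<^esub> f"

definition end_ring :: "('o, 'm, 'z) tri_cat_scheme \<Rightarrow> 'o \<Rightarrow> 'm ring" where
  "end_ring K X = \<lparr>carrier = homs K X X, mult = cmp K, one = idn K X,
     zero = nul K X X, add = plus K\<rparr>"

definition is_zero :: "('o, 'm, 'z) tri_cat_scheme \<Rightarrow> 'o \<Rightarrow> bool" where
  "is_zero K Z \<longleftrightarrow> Z \<in> ob K \<and> idn K Z = nul K Z Z"

locale additive_category = category K for K :: "('o, 'm, 'z) tri_cat_scheme" (structure) +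
  assumes hom_comm_group: "\<lbrakk>X \<in> ob K; Y \<in> ob K\<rbrakk> \<Longrightarrow> comm_group (hom_group K X Y)"
    and cmp_plus_left: "\<lbrakk>f \<in> homs K X Y; g \<in> homs K Y Z; h \<in> homs K Y Z\<rbrakk>
      \<Longrightarrow> plus K g h \<cdot> f = plus K (g \<cdot> f) (h \<cdot> f)"
    and cmp_plus_right: "\<lbrakk>f \<in> homs K X Y; g \<in> homs K X Y; h \<in> homs K Y Z\<rbrakk>
      \<Longrightarrow> h \<cdot> plus K f g = plus K (h \<cdot> f) (h \<cdot> g)"
    and zero_object: "\<exists>Z. is_zero K Z"
    and biproduct: "\<lbrakk>X \<in> ob K; Y \<in> ob K\<rbrakk> \<Longrightarrow>
      \<exists>S \<in> ob K. \<exists>i \<in> homs K X S. \<exists>j \<in> homs K Y S. \<exists>p \<in> homs K S X. \<exists>q \<in> homs K S Y.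
        p \<cdot> i = idn K X \<and> q \<cdot> j = idn K Y \<and> p \<cdot> j = nul K Y X \<and> q \<cdot> i = nul K X Y \<and>
        plus K (i \<cdot> p) (j \<cdot> q) = idn K S"

definition additive_endofunctor ::
    "('o, 'm, 'z) tri_cat_scheme \<Rightarrow> ('o \<Rightarrow> 'o) \<Rightarrow> ('m \<Rightarrow> 'm) \<Rightarrow> bool" where
  "additive_endofunctor K Fo Fa \<longleftrightarrow> endofunctor K Fo Fa \<and>
     (\<forall>X Y. \<forall>f \<in> homs K X Y. \<forall>g \<in> homs K X Y. Fa (plus K f g) = plus K (Fa f) (Fa g))"

text \<open>The suspension is an autoequivalence and not necessarily invertible on the nose.\<close>

locale triangulated_category = additive_category +
  assumes susp_additive: "additive_endofunctor K (suspO K) (suspA K)"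
    and susp_equivalence: "autoequivalence K (suspO K) (suspA K)"
    and dist_homs: "(f, g, h) \<in> dist K \<Longrightarrow>
      f \<in> arr K \<and> g \<in> homs K (cd K f) (dm K h) \<and> h \<in> homs K (cd K g) (suspO K (dm K f))"
    and dist_iso: "\<lbrakk>(f, g, h) \<in> dist K;
        f' \<in> homs K X' Y'; g' \<in> homs K Y' Z'; h' \<in> homs K Z' (suspO K X');
        a \<in> homs K (dm K f) X'; b \<in> homs K (dm K g) Y'; c \<in> homs K (dm K h) Z';
        iso_arr K a; iso_arr K b; iso_arr K c;
        b \<cdot> f = f' \<cdot> a; c \<cdot> g = g' \<cdot> b; suspA K a \<cdot> h = h' \<cdot> c\<rbrakk>
      \<Longrightarrow> (f', g', h') \<in> dist K"
    and dist_idn: "\<lbrakk>X \<in> ob K; is_zero K Z\<rbrakk>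
      \<Longrightarrow> (idn K X, nul K X Z, nul K Z (suspO K X)) \<in> dist K"
    and dist_cone: "f \<in> arr K \<Longrightarrow> \<exists>g h. (f, g, h) \<in> dist K"
    and dist_rotate: "\<lbrakk>f \<in> homs K X Y; g \<in> homs K Y Z; h \<in> homs K Z (suspO K X)\<rbrakk>
      \<Longrightarrow> (f, g, h) \<in> dist K \<longleftrightarrow> (g, h, neg K (suspA K f)) \<in> dist K"
    and dist_fill: "\<lbrakk>(f, g, h) \<in> dist K; (f', g', h') \<in> dist K;
        a \<in> homs K (dm K f) (dm K f'); b \<in> homs K (dm K g) (dm K g'); b \<cdot> f = f' \<cdot> a\<rbrakk>
      \<Longrightarrow> \<exists>c \<in> homs K (dm K h) (dm K h'). c \<cdot> g = g' \<cdot> b \<and> suspA K a \<cdot> h = h' \<cdot> c"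
    and octahedral: "\<lbrakk>f \<in> homs K X Y; g \<in> homs K Y Z;
        (f, f1, f2) \<in> dist K; (g, g1, g2) \<in> dist K; (g \<cdot> f, h1, h2) \<in> dist K\<rbrakk>
      \<Longrightarrow> \<exists>u v. (u, v, suspA K f1 \<cdot> g2) \<in> dist K \<and>
            u \<cdot> f1 = h1 \<cdot> g \<and> h2 \<cdot> u = f2 \<and> v \<cdot> h1 = g1 \<and> g2 \<cdot> v = suspA K f \<cdot> h2"

definition exact_endofunctor ::
    "('o, 'm, 'z) tri_cat_scheme \<Rightarrow> ('o \<Rightarrow> 'o) \<Rightarrow> ('m \<Rightarrow> 'm) \<Rightarrow> bool" where
  "exact_endofunctor K Fo Fa \<longleftrightarrow> additive_endofunctor K Fo Fa \<and>
     (\<exists>e. (\<forall>X \<in> ob K. e X \<in> homs K (Fo (suspO K X)) (suspO K (Fo X)) \<and> iso_arr K (e X)) \<and>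
          (\<forall>X Y. \<forall>f \<in> homs K X Y. e Y \<cdot>\<^bsub>K\<^esub> Fa (suspA K f) = suspA K (Fa f) \<cdot>\<^bsub>K\<^esub> e X) \<and>
          (\<forall>(f, g, h) \<in> dist K. (Fa f, Fa g, e (dm K f) \<cdot>\<^bsub>K\<^esub> Fa h) \<in> dist K))"

definition thick :: "('o, 'm, 'z) tri_cat_scheme \<Rightarrow> 'o set \<Rightarrow> bool" where
  "thick K S \<longleftrightarrow> S \<subseteq> ob K \<and> (\<forall>Z. is_zero K Z \<longrightarrow> Z \<in> S) \<and>
     (\<forall>X \<in> ob K. suspO K X \<in> S \<longleftrightarrow> X \<in> S) \<and>
     (\<forall>(f, g, h) \<in> dist K.
        (dm K f \<in> S \<and> dm K g \<in> S \<longrightarrow> dm K h \<in> S) \<and>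
        (dm K g \<in> S \<and> dm K h \<in> S \<longrightarrow> dm K f \<in> S) \<and>
        (dm K f \<in> S \<and> dm K h \<in> S \<longrightarrow> dm K g \<in> S)) \<and>
     (\<forall>X \<in> S. \<forall>Y \<in> ob K. \<forall>s \<in> homs K Y X. \<forall>r \<in> homs K X Y. r \<cdot>\<^bsub>K\<^esub> s = idn K Y \<longrightarrow> Y \<in> S)"

definition thick_hull :: "('o, 'm, 'z) tri_cat_scheme \<Rightarrow> 'o set \<Rightarrow> 'o set" where
  "thick_hull K A = \<Inter>{S. thick K S \<and> A \<subseteq> S}"


subsection \<open>Symmetric monoidal structures\<close>

record ('o, 'm) tt_cat = "('o, 'm) tri_cat" +
  tensO :: "'o \<Rightarrow> 'o \<Rightarrow> 'o"  (infixr "\<boxtimes>\<index>" 75)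
  tensA :: "'m \<Rightarrow> 'm \<Rightarrow> 'm"  (infixr "\<boxdot>\<index>" 75)
  unit_ob :: "'o"
  assoc :: "'o \<Rightarrow> 'o \<Rightarrow> 'o \<Rightarrow> 'm"
  lunit :: "'o \<Rightarrow> 'm"
  runit :: "'o \<Rightarrow> 'm"
  braid :: "'o \<Rightarrow> 'o \<Rightarrow> 'm"

locale symmetric_monoidal_category =
  category K for K :: "('o, 'm, 'z) tt_cat_scheme" (structure) +
  assumes tens_ob: "\<lbrakk>X \<in> ob K; Y \<in> ob K\<rbrakk> \<Longrightarrow> X \<boxtimes> Y \<in> ob K"
    and tens_homs: "\<lbrakk>f \<in> homs K X X'; g \<in> homs K Y Y'\<rbrakk> \<Longrightarrow> f \<boxdot> g \<in> homs K (X \<boxtimes> Y) (X' \<boxtimes> Y')"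
    and tens_idn: "\<lbrakk>X \<in> ob K; Y \<in> ob K\<rbrakk> \<Longrightarrow> idn K X \<boxdot> idn K Y = idn K (X \<boxtimes> Y)"
    and tens_cmp: "\<lbrakk>f \<in> homs K X X'; f' \<in> homs K X' X''; g \<in> homs K Y Y'; g' \<in> homs K Y' Y''\<rbrakk>
      \<Longrightarrow> (f' \<cdot> f) \<boxdot> (g' \<cdot> g) = (f' \<boxdot> g') \<cdot> (f \<boxdot> g)"
    and unit_ob: "unit_ob K \<in> ob K"
    and assoc_homs: "\<lbrakk>X \<in> ob K; Y \<in> ob K; Z \<in> ob K\<rbrakk>
      \<Longrightarrow> assoc K X Y Z \<in> homs K ((X \<boxtimes> Y) \<boxtimes> Z) (X \<boxtimes> (Y \<boxtimes> Z)) \<and> iso_arr K (assoc K X Y Z)"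
    and lunit_homs: "X \<in> ob K \<Longrightarrow> lunit K X \<in> homs K (unit_ob K \<boxtimes> X) X \<and> iso_arr K (lunit K X)"
    and runit_homs: "X \<in> ob K \<Longrightarrow> runit K X \<in> homs K (X \<boxtimes> unit_ob K) X \<and> iso_arr K (runit K X)"
    and braid_homs: "\<lbrakk>X \<in> ob K; Y \<in> ob K\<rbrakk> \<Longrightarrow> braid K X Y \<in> homs K (X \<boxtimes> Y) (Y \<boxtimes> X)"
    and assoc_natural: "\<lbrakk>f \<in> homs K X X'; g \<in> homs K Y Y'; h \<in> homs K Z Z'\<rbrakk>
      \<Longrightarrow> assoc K X' Y' Z' \<cdot> ((f \<boxdot> g) \<boxdot> h) = (f \<boxdot> (g \<boxdot> h)) \<cdot> assoc K X Y Z"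
    and lunit_natural: "f \<in> homs K X Y \<Longrightarrow> lunit K Y \<cdot> (idn K (unit_ob K) \<boxdot> f) = f \<cdot> lunit K X"
    and runit_natural: "f \<in> homs K X Y \<Longrightarrow> runit K Y \<cdot> (f \<boxdot> idn K (unit_ob K)) = f \<cdot> runit K X"
    and braid_natural: "\<lbrakk>f \<in> homs K X X'; g \<in> homs K Y Y'\<rbrakk>
      \<Longrightarrow> braid K X' Y' \<cdot> (f \<boxdot> g) = (g \<boxdot> f) \<cdot> braid K X Y"
    and pentagon: "\<lbrakk>W \<in> ob K; X \<in> ob K; Y \<in> ob K; Z \<in> ob K\<rbrakk>
      \<Longrightarrow> assoc K W X (Y \<boxtimes> Z) \<cdot> assoc K (W \<boxtimes> X) Y Z =
          (idn K W \<boxdot> assoc K X Y Z) \<cdot> assoc K W (X \<boxtimes> Y) Z \<cdot> (assoc K W X Y \<boxdot> idn K Z)"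
    and triangle: "\<lbrakk>X \<in> ob K; Y \<in> ob K\<rbrakk>
      \<Longrightarrow> (idn K X \<boxdot> lunit K Y) \<cdot> assoc K X (unit_ob K) Y = runit K X \<boxdot> idn K Y"
    and hexagon: "\<lbrakk>X \<in> ob K; Y \<in> ob K; Z \<in> ob K\<rbrakk>
      \<Longrightarrow> assoc K Y Z X \<cdot> braid K X (Y \<boxtimes> Z) \<cdot> assoc K X Y Z =
          (idn K Y \<boxdot> braid K X Z) \<cdot> assoc K Y X Z \<cdot> (braid K X Y \<boxdot> idn K Z)"
    and braid_braid: "\<lbrakk>X \<in> ob K; Y \<in> ob K\<rbrakk> \<Longrightarrow> braid K Y X \<cdot> braid K X Y = idn K (X \<boxtimes> Y)"

locale tt_category =
  triangulated_category K + symmetric_monoidal_category K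
  for K :: "('o, 'm, 'z) tt_cat_scheme" (structure) +
  assumes tens_exact_left: "Y \<in> ob K \<Longrightarrow> exact_endofunctor K (\<lambda>X. X \<boxtimes> Y) (\<lambda>f. f \<boxdot> idn K Y)"
    and tens_exact_right: "X \<in> ob K \<Longrightarrow> exact_endofunctor K (\<lambda>Y. X \<boxtimes> Y) (\<lambda>f. idn K X \<boxdot> f)"

definition unigenic :: "('o, 'm, 'z) tt_cat_scheme \<Rightarrow> bool" where
  "unigenic K \<longleftrightarrow> thick_hull K {unit_ob K} = ob K"

text \<open>For a negative integer \<open>i\<close> the functor \<open>\<Sigma>\<close> to the power \<open>-i\<close> is a positive iterate of the suspension.\<close>

definition connective :: "('o, 'm, 'z) tt_cat_scheme \<Rightarrow> bool" where
  "connective K \<longleftrightarrow> (\<forall>i::int. i < 0 \<longrightarrow>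
     (let X = (suspO K ^^ nat (- i)) (unit_ob K) in homs K (unit_ob K) X = {nul K (unit_ob K) X}))"

definition local_ring :: "('a, 'z) ring_scheme \<Rightarrow> bool" where
  "local_ring R \<longleftrightarrow> cring R \<and> (\<exists>!I. maximalideal I R)"


subsection \<open>The Balmer spectrum\<close>

definition prime_ideal :: "('o, 'm, 'z) tt_cat_scheme \<Rightarrow> 'o set \<Rightarrow> bool" where
  "prime_ideal K P \<longleftrightarrow> thick K P \<and> P \<noteq> ob K \<and>
     (\<forall>a \<in> P. \<forall>b \<in> ob K. a \<boxtimes>\<^bsub>K\<^esub> b \<in> P \<and> b \<boxtimes>\<^bsub>K\<^esub> a \<in> P) \<and>
     (\<forall>a \<in> ob K. \<forall>b \<in> ob K. a \<boxtimes>\<^bsub>K\<^esub> b \<in> P \<longrightarrow> a \<in> P \<or> b \<in> P)"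

definition Spc_supp :: "('o, 'm, 'z) tt_cat_scheme \<Rightarrow> 'o \<Rightarrow> 'o set set" where
  "Spc_supp K a = {P. prime_ideal K P \<and> a \<notin> P}"

definition Spc :: "('o, 'm, 'z) tt_cat_scheme \<Rightarrow> 'o set topology" where
  "Spc K = topology_generated_by {Collect (prime_ideal K) - Spc_supp K a | a. a \<in> ob K}"

definition local_space :: "'a topology \<Rightarrow> bool" where
  "local_space T \<longleftrightarrow> (\<exists>!x. x \<in> topspace T \<and> closedin T {x})"

definition local_tt_category :: "('o, 'm, 'z) tt_cat_scheme \<Rightarrow> bool" where
  "local_tt_category K \<longleftrightarrow> local_space (Spc K)"


section \<open>Quasi-categories\<close>

text \<open>\<open>pull X m n \<theta>\<close> is the map from \<open>n\<close>-simplices to \<open>m\<close>-simplices induced by a monotone map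
  \<open>\<theta>\<close> from \<open>[m] = {..m}\<close> to \<open>[n] = {..n}\<close>; only the values of \<open>\<theta>\<close> on \<open>{..m}\<close> matter.\<close>

record 's sset =
  cells :: "nat \<Rightarrow> 's set"
  pull :: "nat \<Rightarrow> nat \<Rightarrow> (nat \<Rightarrow> nat) \<Rightarrow> 's \<Rightarrow> 's"

definition ord_map :: "nat \<Rightarrow> nat \<Rightarrow> (nat \<Rightarrow> nat) \<Rightarrow> bool" where
  "ord_map m n \<theta> \<longleftrightarrow> mono_on {..m} \<theta> \<and> \<theta> ` {..m} \<subseteq> {..n}"

locale simplicial_set =
  fixes X :: "'s sset"
  assumes pull_cells: "\<lbrakk>ord_map m n \<theta>; x \<in> cells X n\<rbrakk> \<Longrightarrow> pull X m n \<theta> x \<in> cells X m"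
    and pull_cong: "\<lbrakk>ord_map m n \<theta>; \<And>i. i \<le> m \<Longrightarrow> \<theta>' i = \<theta> i; x \<in> cells X n\<rbrakk>
      \<Longrightarrow> pull X m n \<theta>' x = pull X m n \<theta> x"
    and pull_id: "x \<in> cells X n \<Longrightarrow> pull X n n (\<lambda>i. i) x = x"
    and pull_pull: "\<lbrakk>ord_map l m \<eta>; ord_map m n \<theta>; x \<in> cells X n\<rbrakk>
      \<Longrightarrow> pull X l m \<eta> (pull X m n \<theta> x) = pull X l n (\<theta> \<circ> \<eta>) x"

definition smap :: "'s sset \<Rightarrow> 't sset \<Rightarrow> (nat \<Rightarrow> 's \<Rightarrow> 't) \<Rightarrow> bool" where
  "smap X Y u \<longleftrightarrow> (\<forall>n. \<forall>x \<in> cells X n. u n x \<in> cells Y n) \<and>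
     (\<forall>m n \<theta>. ord_map m n \<theta> \<longrightarrow> (\<forall>x \<in> cells X n. u m (pull X m n \<theta> x) = pull Y m n \<theta> (u n x)))"

definition agree_on :: "'s sset \<Rightarrow> (nat \<Rightarrow> 's \<Rightarrow> 't) \<Rightarrow> (nat \<Rightarrow> 's \<Rightarrow> 't) \<Rightarrow> bool" where
  "agree_on X u v \<longleftrightarrow> (\<forall>n. \<forall>x \<in> cells X n. u n x = v n x)"

definition edge :: "'s sset \<Rightarrow> nat \<Rightarrow> nat \<Rightarrow> nat \<Rightarrow> 's \<Rightarrow> 's" where
  "edge X n i j x = pull X 1 n (\<lambda>k. if k = 0 then i else j) x"

definition vertex :: "'s sset \<Rightarrow> nat \<Rightarrow> nat \<Rightarrow> 's \<Rightarrow> 's" where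
  "vertex X n i x = pull X 0 n (\<lambda>_. i) x"

definition degen :: "'s sset \<Rightarrow> nat \<Rightarrow> 's \<Rightarrow> 's" where
  "degen X n x = pull X n 0 (\<lambda>_. 0) x"

definition sprod :: "'s sset \<Rightarrow> 't sset \<Rightarrow> ('s \<times> 't) sset" where
  "sprod X Y = \<lparr>cells = \<lambda>n. cells X n \<times> cells Y n,
     pull = \<lambda>m n \<theta>. map_prod (pull X m n \<theta>) (pull Y m n \<theta>)\<rparr>"

definition spow :: "'i set \<Rightarrow> 's sset \<Rightarrow> ('i \<Rightarrow> 's) sset" where
  "spow I X = \<lparr>cells = \<lambda>n. I \<rightarrow>\<^sub>E cells X n, pull = \<lambda>m n \<theta> x. \<lambda>i\<in>I. pull X m n \<theta> (x i)\<rparr>"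

text \<open>The simplicial subset of the nerve of a poset consisting of the simplices whose set of vertices
  belongs to \<open>\<S>\<close>. For \<open>\<S> = Pow P\<close> this is the nerve of the poset \<open>P\<close>; simplices, their
  boundaries and horns, and joins of these with other posets all have this form.\<close>

definition poset_nerve :: "'v::order set set \<Rightarrow> (nat \<Rightarrow> 'v) sset" where
  "poset_nerve \<S> = \<lparr>cells = \<lambda>n. {\<sigma> \<in> extensional {..n}. mono_on {..n} \<sigma> \<and> \<sigma> ` {..n} \<in> \<S>},
     pull = \<lambda>m n \<theta> \<sigma>. \<lambda>i\<in>{..m}. \<sigma> (\<theta> i)\<rparr>"

definition pvertex :: "'v \<Rightarrow> nat \<Rightarrow> 'v" where
  "pvertex v = (\<lambda>i\<in>{..0}. v)"

definition pedge :: "'v \<Rightarrow> 'v \<Rightarrow> nat \<Rightarrow> 'v" where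
  "pedge v w = (\<lambda>i\<in>{..1}. if i = 0 then v else w)"

definition Simplex :: "nat \<Rightarrow> (nat \<Rightarrow> nat) sset" where
  "Simplex n = poset_nerve (Pow {..n})"

definition Boundary :: "nat \<Rightarrow> (nat \<Rightarrow> nat) sset" where
  "Boundary n = poset_nerve {S. S \<subset> {..n}}"

definition Horn :: "nat \<Rightarrow> nat \<Rightarrow> (nat \<Rightarrow> nat) sset" where
  "Horn n k = poset_nerve {S. S \<subseteq> {..n} \<and> \<not> {..n} - {k} \<subseteq> S}"

definition quasi_category :: "'s sset \<Rightarrow> bool" where
  "quasi_category X \<longleftrightarrow> simplicial_set X \<and>
     (\<forall>n k u. 0 < k \<and> k < n \<and> smap (Horn n k) X u \<longrightarrow>
        (\<exists>w. smap (Simplex n) X w \<and> agree_on (Horn n k) w u))"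


subsection \<open>The homotopy category\<close>

definition homotopic :: "'s sset \<Rightarrow> 's \<Rightarrow> 's \<Rightarrow> bool" where
  "homotopic X f g \<longleftrightarrow> (\<exists>\<sigma> \<in> cells X 2. edge X 2 0 1 \<sigma> = f \<and> edge X 2 0 2 \<sigma> = g \<and>
     edge X 2 1 2 \<sigma> = degen X 1 (vertex X 1 1 f))"

definition hcls :: "'s sset \<Rightarrow> 's \<Rightarrow> 's set" where
  "hcls X f = {g \<in> cells X 1. homotopic X f g}"

definition ho :: "'s sset \<Rightarrow> ('s, 's set) cat" where
  "ho X = \<lparr>ob = cells X 0, arr = hcls X ` cells X 1,
     dm = \<lambda>c. vertex X 1 0 (SOME f. f \<in> c), cd = \<lambda>c. vertex X 1 1 (SOME f. f \<in> c),
     idn = \<lambda>x. hcls X (degen X 1 x),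
     cmp = \<lambda>d c. hcls X (edge X 2 0 2
       (SOME \<sigma>. \<sigma> \<in> cells X 2 \<and> edge X 2 0 1 \<sigma> \<in> c \<and> edge X 2 1 2 \<sigma> \<in> d))\<rparr>"

definition equiv_edge :: "'s sset \<Rightarrow> 's \<Rightarrow> bool" where
  "equiv_edge X f \<longleftrightarrow> f \<in> cells X 1 \<and> iso_arr (ho X) (hcls X f)"

definition nat_equiv ::
    "'s sset \<Rightarrow> 't sset \<Rightarrow> (nat \<Rightarrow> 's \<Rightarrow> 't) \<Rightarrow> (nat \<Rightarrow> 's \<Rightarrow> 't) \<Rightarrow> bool" where
  "nat_equiv X Y F G \<longleftrightarrow> (\<exists>H. smap (sprod (Simplex 1) X) Y H \<and>
     (\<forall>n. \<forall>x \<in> cells X n. H n ((\<lambda>i\<in>{..n}. 0), x) = F n x \<and> H n ((\<lambda>i\<in>{..n}. 1), x) = G n x) \<and>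
     (\<forall>x \<in> cells X 0. equiv_edge Y (H 1 (pedge 0 1, degen X 1 x))))"

definition quasi_equivalence :: "'s sset \<Rightarrow> 't sset \<Rightarrow> (nat \<Rightarrow> 's \<Rightarrow> 't) \<Rightarrow> bool" where
  "quasi_equivalence X Y F \<longleftrightarrow> smap X Y F \<and>
     (\<exists>G. smap Y X G \<and> nat_equiv X X (\<lambda>n x. x) (\<lambda>n x. G n (F n x)) \<and>
          nat_equiv Y Y (\<lambda>n y. F n (G n y)) (\<lambda>n y. y))"


subsection \<open>Stable quasi-categories\<close>

definition initial_vertex :: "'s sset \<Rightarrow> 's \<Rightarrow> bool" where
  "initial_vertex X z \<longleftrightarrow> z \<in> cells X 0 \<and>
     (\<forall>n \<ge> 1. \<forall>u. smap (Boundary n) X u \<and> u 0 (pvertex 0) = z \<longrightarrow>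
        (\<exists>w. smap (Simplex n) X w \<and> agree_on (Boundary n) w u))"

definition final_vertex :: "'s sset \<Rightarrow> 's \<Rightarrow> bool" where
  "final_vertex X z \<longleftrightarrow> z \<in> cells X 0 \<and>
     (\<forall>n \<ge> 1. \<forall>u. smap (Boundary n) X u \<and> u 0 (pvertex n) = z \<longrightarrow>
        (\<exists>w. smap (Simplex n) X w \<and> agree_on (Boundary n) w u))"

definition zero_vertex :: "'s sset \<Rightarrow> 's \<Rightarrow> bool" where
  "zero_vertex X z \<longleftrightarrow> initial_vertex X z \<and> final_vertex X z"

text \<open>Squares are indexed by (row, column), with the componentwise order on pairs. The poset
  \<open>span_join n\<close> is the join of the span \<open>(1,0) \<leftarrow> (0,0) \<rightarrow> (0,1)\<close> with the chain
  \<open>(1,1) < \<dots> < (1+n,1+n)\<close>. A square is a pushout if it is initial among the cocones on its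
  span: every extension of it to the join of the span with the boundary of the \<open>n\<close>-simplex
  extends further to the join with the \<open>n\<close>-simplex. Dually for pullbacks.\<close>

type_synonym 's square = "nat \<Rightarrow> (nat \<Rightarrow> int \<times> int) \<Rightarrow> 's"

abbreviation Square :: "(nat \<Rightarrow> int \<times> int) sset" where
  "Square \<equiv> poset_nerve (Pow ({0, 1} \<times> {0, 1}))"

definition upper_diag :: "nat \<Rightarrow> (int \<times> int) set" where
  "upper_diag n = (\<lambda>i. (1 + int i, 1 + int i)) ` {..n}"

definition span_join :: "nat \<Rightarrow> (int \<times> int) set" where
  "span_join n = {(0, 0), (0, 1), (1, 0)} \<union> upper_diag n"

definition pushout_square :: "'s sset \<Rightarrow> 's square \<Rightarrow> bool" where
  "pushout_square X q \<longleftrightarrow> smap Square X q \<and>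
     (\<forall>n \<ge> 1. \<forall>u. smap (poset_nerve {S. S \<subseteq> span_join n \<and> \<not> upper_diag n \<subseteq> S}) X u \<and>
          agree_on Square u q \<longrightarrow>
        (\<exists>w. smap (poset_nerve (Pow (span_join n))) X w \<and>
          agree_on (poset_nerve {S. S \<subseteq> span_join n \<and> \<not> upper_diag n \<subseteq> S}) w u))"

definition lower_diag :: "nat \<Rightarrow> (int \<times> int) set" where
  "lower_diag n = (\<lambda>i. (- int i, - int i)) ` {..n}"

definition cospan_join :: "nat \<Rightarrow> (int \<times> int) set" where
  "cospan_join n = {(0, 1), (1, 0), (1, 1)} \<union> lower_diag n"

definition pullback_square :: "'s sset \<Rightarrow> 's square \<Rightarrow> bool" where
  "pullback_square X q \<longleftrightarrow> smap Square X q \<and>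
     (\<forall>n \<ge> 1. \<forall>u. smap (poset_nerve {S. S \<subseteq> cospan_join n \<and> \<not> lower_diag n \<subseteq> S}) X u \<and>
          agree_on Square u q \<longrightarrow>
        (\<exists>w. smap (poset_nerve (Pow (cospan_join n))) X w \<and>
          agree_on (poset_nerve {S. S \<subseteq> cospan_join n \<and> \<not> lower_diag n \<subseteq> S}) w u))"

definition null_square :: "'s sset \<Rightarrow> 's square \<Rightarrow> bool" where
  "null_square X q \<longleftrightarrow> smap Square X q \<and> zero_vertex X (q 0 (pvertex (1, 0)))"

definition stable_quasi_category :: "'s sset \<Rightarrow> bool" where
  "stable_quasi_category X \<longleftrightarrow> quasi_category X \<and> (\<exists>z. zero_vertex X z) \<and>
     (\<forall>f \<in> cells X 1. \<exists>q. null_square X q \<and> pullback_square X q \<and> q 1 (pedge (0, 1) (1, 1)) = f) \<and>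
     (\<forall>f \<in> cells X 1. \<exists>q. null_square X q \<and> pushout_square X q \<and> q 1 (pedge (0, 0) (0, 1)) = f) \<and>
     (\<forall>q. null_square X q \<longrightarrow> (pullback_square X q \<longleftrightarrow> pushout_square X q))"


subsection \<open>The triangulation of the homotopy category\<close>

definition suspension_square :: "'s sset \<Rightarrow> 's \<Rightarrow> 's \<Rightarrow> 's square \<Rightarrow> bool" where
  "suspension_square X x y q \<longleftrightarrow> pushout_square X q \<and> q 0 (pvertex (0, 0)) = x \<and>
     q 0 (pvertex (1, 1)) = y \<and>
     zero_vertex X (q 0 (pvertex (0, 1))) \<and> zero_vertex X (q 0 (pvertex (1, 0)))"

text \<open>A morphism of squares with classes \<open>f\<close> and \<open>g\<close> at the initial and the final corner.\<close>

definition square_morphism ::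
    "'s sset \<Rightarrow> 's square \<Rightarrow> 's square \<Rightarrow> 's set \<Rightarrow> 's set \<Rightarrow> bool" where
  "square_morphism X q q' f g \<longleftrightarrow>
     (\<exists>c. smap (poset_nerve (Pow ({0::int, 1} \<times> {0::int, 1} \<times> {0::int, 1}))) X c \<and>
        agree_on Square (\<lambda>n \<sigma>. c n (\<lambda>i\<in>{..n}. (0, \<sigma> i))) q \<and>
        agree_on Square (\<lambda>n \<sigma>. c n (\<lambda>i\<in>{..n}. (1, \<sigma> i))) q' \<and>
        hcls X (c 1 (pedge (0, 0, 0) (1, 0, 0))) = f \<and>
        hcls X (c 1 (pedge (0, 1, 1) (1, 1, 1))) = g)"

text \<open>A diagram
    \<open>x \<rightarrow> y \<rightarrow> 0\<close> over \<open>0' \<rightarrow> z \<rightarrow> w\<close>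
  in which both squares are pushouts; the outer rectangle identifies \<open>w\<close> with the suspension
  of \<open>x\<close> (chosen by means of the suspension squares \<open>sq\<close>).\<close>

definition ho_triangle :: "'s sset \<Rightarrow> ('s \<Rightarrow> 's square) \<Rightarrow> 's set \<Rightarrow> 's set \<Rightarrow> 's set \<Rightarrow> bool" where
  "ho_triangle X sq f g h \<longleftrightarrow>
     (\<exists>r e. smap (poset_nerve (Pow ({0::int, 1} \<times> {0::int, 1, 2}))) X r \<and>
        zero_vertex X (r 0 (pvertex (0, 2))) \<and> zero_vertex X (r 0 (pvertex (1, 0))) \<and>
        pushout_square X r \<and>
        pushout_square X (\<lambda>n \<sigma>. r n (\<lambda>i\<in>{..n}. (fst (\<sigma> i), snd (\<sigma> i) + 1))) \<and>
        f = hcls X (r 1 (pedge (0, 0) (0, 1))) \<and>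
        g = hcls X (r 1 (pedge (0, 1) (1, 1))) \<and>
        square_morphism X (\<lambda>n \<sigma>. r n (\<lambda>i\<in>{..n}. (fst (\<sigma> i), 2 * snd (\<sigma> i))))
          (sq (r 0 (pvertex (0, 0)))) (idn (ho X) (r 0 (pvertex (0, 0)))) e \<and>
        h = e \<cdot>\<^bsub>ho X\<^esub> hcls X (r 1 (pedge (1, 1) (1, 2))))"

definition induced_triangulation :: "'s sset \<Rightarrow> ('s, 's set, 'z) tri_cat_scheme \<Rightarrow> bool" where
  "induced_triangulation X K \<longleftrightarrow>
     (\<exists>sq. (\<forall>x \<in> ob K. suspension_square X x (suspO K x) (sq x)) \<and>
           (\<forall>f \<in> arr K. square_morphism X (sq (dm K f)) (sq (cd K f)) f (suspA K f)) \<and>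
           dist K = {(f, g, h). ho_triangle X sq f g h})"


section \<open>Symmetric monoidal quasi-categories\<close>

subsection \<open>Cocartesian fibrations\<close>

definition cocart_edge :: "'s sset \<Rightarrow> 't sset \<Rightarrow> (nat \<Rightarrow> 's \<Rightarrow> 't) \<Rightarrow> 's \<Rightarrow> bool" where
  "cocart_edge X S p f \<longleftrightarrow> f \<in> cells X 1 \<and>
     (\<forall>n \<ge> 2. \<forall>u v. smap (Horn n 0) X u \<and> smap (Simplex n) S v \<and>
          agree_on (Horn n 0) (\<lambda>k \<sigma>. p k (u k \<sigma>)) v \<and> u 1 (pedge 0 1) = f \<longrightarrow>
        (\<exists>w. smap (Simplex n) X w \<and> agree_on (Horn n 0) w u \<and>
          agree_on (Simplex n) (\<lambda>k \<sigma>. p k (w k \<sigma>)) v))"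

definition inner_fibration :: "'s sset \<Rightarrow> 't sset \<Rightarrow> (nat \<Rightarrow> 's \<Rightarrow> 't) \<Rightarrow> bool" where
  "inner_fibration X S p \<longleftrightarrow> simplicial_set X \<and> simplicial_set S \<and> smap X S p \<and>
     (\<forall>n k u v. 0 < k \<and> k < n \<and> smap (Horn n k) X u \<and> smap (Simplex n) S v \<and>
          agree_on (Horn n k) (\<lambda>i \<sigma>. p i (u i \<sigma>)) v \<longrightarrow>
        (\<exists>w. smap (Simplex n) X w \<and> agree_on (Horn n k) w u \<and>
          agree_on (Simplex n) (\<lambda>i \<sigma>. p i (w i \<sigma>)) v))"

definition cocart_fibration :: "'s sset \<Rightarrow> 't sset \<Rightarrow> (nat \<Rightarrow> 's \<Rightarrow> 't) \<Rightarrow> bool" where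
  "cocart_fibration X S p \<longleftrightarrow> inner_fibration X S p \<and>
     (\<forall>a \<in> cells S 1. \<forall>x \<in> cells X 0. p 0 x = vertex S 1 0 a \<longrightarrow>
        (\<exists>f. cocart_edge X S p f \<and> vertex X 1 0 f = x \<and> p 1 f = a))"

definition fiber :: "'s sset \<Rightarrow> 't sset \<Rightarrow> (nat \<Rightarrow> 's \<Rightarrow> 't) \<Rightarrow> 't \<Rightarrow> 's sset" where
  "fiber X S p s = X\<lparr>cells := \<lambda>n. {x \<in> cells X n. p n x = degen S n s}\<rparr>"

text \<open>The functor \<open>\<phi>\<close> between fibres is obtained by transport along the edge \<open>a\<close> of the base.\<close>

definition cocart_transport ::
    "'s sset \<Rightarrow> 't sset \<Rightarrow> (nat \<Rightarrow> 's \<Rightarrow> 't) \<Rightarrow> 't \<Rightarrow> (nat \<Rightarrow> 's \<Rightarrow> 's) \<Rightarrow> bool" where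
  "cocart_transport X S p a \<phi> \<longleftrightarrow>
     (let A = fiber X S p (vertex S 1 0 a) in
      \<exists>H. smap (sprod (Simplex 1) A) X H \<and>
        (\<forall>n. \<forall>x \<in> cells A n. H n ((\<lambda>i\<in>{..n}. 0), x) = x \<and> H n ((\<lambda>i\<in>{..n}. 1), x) = \<phi> n x) \<and>
        (\<forall>n. \<forall>\<tau> \<in> cells (Simplex 1) n. \<forall>x \<in> cells A n. p n (H n (\<tau>, x)) = pull S n 1 \<tau> a) \<and>
        (\<forall>x \<in> cells A 0. cocart_edge X S p (H 1 (pedge 0 1, degen A 1 x))))"


subsection \<open>Finite pointed sets\<close>

text \<open>An \<open>n\<close>-simplex of the nerve, a functor from \<open>[n]\<close>, is encoded by the arrows
  \<open>F i j\<close> for \<open>i \<le> j \<le> n\<close>.\<close>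

definition nerve :: "('o, 'm, 'z) cat_scheme \<Rightarrow> (nat \<Rightarrow> nat \<Rightarrow> 'm) sset" where
  "nerve C = \<lparr>cells = \<lambda>n. {F. (\<forall>i j. \<not> (i \<le> j \<and> j \<le> n) \<longrightarrow> F i j = undefined) \<and>
       (\<exists>x. (\<forall>i \<le> n. x i \<in> ob C \<and> F i i = idn C (x i)) \<and>
            (\<forall>i j. i \<le> j \<and> j \<le> n \<longrightarrow> F i j \<in> homs C (x i) (x j)) \<and>
            (\<forall>i j k. i \<le> j \<and> j \<le> k \<and> k \<le> n \<longrightarrow> F j k \<cdot>\<^bsub>C\<^esub> F i j = F i k))},
     pull = \<lambda>m n \<theta> F i j. if i \<le> j \<and> j \<le> m then F (\<theta> i) (\<theta> j) else undefined\<rparr>"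

definition nerve_vertex :: "('o, 'm, 'z) cat_scheme \<Rightarrow> 'o \<Rightarrow> nat \<Rightarrow> nat \<Rightarrow> 'm" where
  "nerve_vertex C x = (\<lambda>i j. if i \<le> j \<and> j \<le> 0 then idn C x else undefined)"

definition nerve_edge :: "('o, 'm, 'z) cat_scheme \<Rightarrow> 'm \<Rightarrow> nat \<Rightarrow> nat \<Rightarrow> 'm" where
  "nerve_edge C f = (\<lambda>i j. if i \<le> j \<and> j \<le> 1
     then (if i < j then f else idn C (if i = 0 then dm C f else cd C f)) else undefined)"

text \<open>The object \<open>n\<close> of \<open>Fin_pt\<close> is the set \<open>{0, \<dots>, n}\<close> with base point \<open>0\<close>.\<close>

type_synonym pt_map = "nat \<times> (nat \<Rightarrow> nat) \<times> nat"

definition Fin_pt :: "(nat, pt_map) cat" where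
  "Fin_pt = \<lparr>ob = UNIV, arr = {(n, \<alpha>, m). \<alpha> \<in> {..n} \<rightarrow>\<^sub>E {..m} \<and> \<alpha> 0 = 0},
     dm = \<lambda>(n, \<alpha>, m). n, cd = \<lambda>(n, \<alpha>, m). m, idn = \<lambda>n. (n, \<lambda>i\<in>{..n}. i, n),
     cmp = \<lambda>(_, \<beta>, l) (n, \<alpha>, _). (n, \<lambda>i\<in>{..n}. \<beta> (\<alpha> i), l)\<rparr>"

text \<open>\<open>ptm n m js\<close> is the pointed map sending \<open>1, \<dots>, n\<close> to the successive entries of \<open>js\<close>.\<close>

definition ptm :: "nat \<Rightarrow> nat \<Rightarrow> nat list \<Rightarrow> pt_map" where
  "ptm n m js = (n, \<lambda>i\<in>{..n}. (0 # js) ! i, m)"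

definition inert_proj :: "nat \<Rightarrow> nat \<Rightarrow> pt_map" where
  "inert_proj n j = (n, \<lambda>i\<in>{..n}. if i = j then 1 else 0, 1)"


subsection \<open>Symmetric monoidal quasi-categories\<close>

type_synonym 's over_Fin = "nat \<Rightarrow> 's \<Rightarrow> nat \<Rightarrow> nat \<Rightarrow> pt_map"

definition fib :: "'s sset \<Rightarrow> 's over_Fin \<Rightarrow> nat \<Rightarrow> 's sset" where
  "fib X p n = fiber X (nerve Fin_pt) p (nerve_vertex Fin_pt n)"

definition symmetric_monoidal_quasi_category :: "'s sset \<Rightarrow> 's over_Fin \<Rightarrow> bool" where
  "symmetric_monoidal_quasi_category X p \<longleftrightarrow> cocart_fibration X (nerve Fin_pt) p \<and>
     (\<forall>n. \<exists>\<phi>. (\<forall>j \<in> {1..n}.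
            cocart_transport X (nerve Fin_pt) p (nerve_edge Fin_pt (inert_proj n j)) (\<phi> j)) \<and>
          quasi_equivalence (fib X p n) (spow {1..n} (fib X p 1)) (\<lambda>k x. \<lambda>j\<in>{1..n}. \<phi> j k x))"

text \<open>The underlying quasi-category is the fibre over \<open>1\<close>.\<close>

definition symmetric_monoidal_stable_quasi_category :: "'s sset \<Rightarrow> 's over_Fin \<Rightarrow> bool" where
  "symmetric_monoidal_stable_quasi_category X p \<longleftrightarrow>
     symmetric_monoidal_quasi_category X p \<and> stable_quasi_category (fib X p 1)"


subsection \<open>The symmetric monoidal structure of the homotopy category\<close>

definition arr_over :: "'s sset \<Rightarrow> 's over_Fin \<Rightarrow> pt_map \<Rightarrow> 's \<Rightarrow> 's \<Rightarrow> 's set set" where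
  "arr_over X p a x y = {hcls X f | f. f \<in> cells X 1 \<and> vertex X 1 0 f = x \<and> vertex X 1 1 f = y \<and>
     p 1 f = nerve_edge Fin_pt a}"

definition cocart_over :: "'s sset \<Rightarrow> 's over_Fin \<Rightarrow> pt_map \<Rightarrow> 's \<Rightarrow> 's \<Rightarrow> 's set set" where
  "cocart_over X p a x y = {hcls X f | f. cocart_edge X (nerve Fin_pt) p f \<and>
     vertex X 1 0 f = x \<and> vertex X 1 1 f = y \<and> p 1 f = nerve_edge Fin_pt a}"

text \<open>A choice of tensor products: \<open>T x y\<close> is an object over \<open>2\<close> with components \<open>x\<close>, \<open>y\<close>
  (via the inert maps \<open>\<pi>1 x y\<close>, \<open>\<pi>2 x y\<close>) and \<open>\<mu> x y\<close> is the class of a cocartesian edge from it to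
  the tensor product over the active map from \<open>2\<close> to \<open>1\<close>; likewise \<open>\<eta>\<close> starts at an object \<open>u\<close>
  over \<open>0\<close> and ends at the unit. The arrows in the homotopy category of \<open>X\<close> that are existentially
  quantified below are uniquely determined by the displayed equations, and these equations
  determine the tensor product of arrows and the constraint isomorphisms of \<open>K\<close>.\<close>

definition induced_monoidal ::
    "'s sset \<Rightarrow> 's over_Fin \<Rightarrow> ('s, 's set, 'z) tt_cat_scheme \<Rightarrow> bool" where
  "induced_monoidal X p K \<longleftrightarrow>
    (\<exists>T \<pi>1 \<pi>2 \<mu> u \<eta>.
      (\<forall>x \<in> ob K. \<forall>y \<in> ob K. T x y \<in> cells (fib X p 2) 0 \<and>
         \<pi>1 x y \<in> cocart_over X p (ptm 2 1 [1, 0]) (T x y) x \<and>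
         \<pi>2 x y \<in> cocart_over X p (ptm 2 1 [0, 1]) (T x y) y \<and>
         \<mu> x y \<in> cocart_over X p (ptm 2 1 [1, 1]) (T x y) (x \<boxtimes>\<^bsub>K\<^esub> y)) \<and>
      u \<in> cells (fib X p 0) 0 \<and> \<eta> \<in> cocart_over X p (ptm 0 1 []) u (unit_ob K) \<and>
      (\<forall>x x' y y'. \<forall>f \<in> homs K x x'. \<forall>g \<in> homs K y y'.
         \<exists>t \<in> arr_over X p (ptm 2 2 [1, 2]) (T x y) (T x' y').
           \<pi>1 x' y' \<cdot>\<^bsub>ho X\<^esub> t = f \<cdot>\<^bsub>ho X\<^esub> \<pi>1 x y \<and> \<pi>2 x' y' \<cdot>\<^bsub>ho X\<^esub> t = g \<cdot>\<^bsub>ho X\<^esub> \<pi>2 x y \<and>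
           (f \<boxdot>\<^bsub>K\<^esub> g) \<cdot>\<^bsub>ho X\<^esub> \<mu> x y = \<mu> x' y' \<cdot>\<^bsub>ho X\<^esub> t) \<and>
      (\<forall>x \<in> ob K. \<forall>y \<in> ob K.
         \<exists>s \<in> arr_over X p (ptm 2 2 [2, 1]) (T x y) (T y x).
           \<pi>1 y x \<cdot>\<^bsub>ho X\<^esub> s = \<pi>2 x y \<and> \<pi>2 y x \<cdot>\<^bsub>ho X\<^esub> s = \<pi>1 x y \<and>
           braid K x y \<cdot>\<^bsub>ho X\<^esub> \<mu> x y = \<mu> y x \<cdot>\<^bsub>ho X\<^esub> s) \<and>
      (\<forall>x \<in> ob K. \<exists>z \<in> arr_over X p (ptm 1 0 [0]) x u.
         (\<exists>e \<in> arr_over X p (ptm 1 2 [2]) x (T (unit_ob K) x).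
           \<pi>1 (unit_ob K) x \<cdot>\<^bsub>ho X\<^esub> e = \<eta> \<cdot>\<^bsub>ho X\<^esub> z \<and>
           \<pi>2 (unit_ob K) x \<cdot>\<^bsub>ho X\<^esub> e = idn (ho X) x \<and>
           lunit K x \<cdot>\<^bsub>ho X\<^esub> (\<mu> (unit_ob K) x \<cdot>\<^bsub>ho X\<^esub> e) = idn (ho X) x) \<and>
         (\<exists>e \<in> arr_over X p (ptm 1 2 [1]) x (T x (unit_ob K)).
           \<pi>1 x (unit_ob K) \<cdot>\<^bsub>ho X\<^esub> e = idn (ho X) x \<and>
           \<pi>2 x (unit_ob K) \<cdot>\<^bsub>ho X\<^esub> e = \<eta> \<cdot>\<^bsub>ho X\<^esub> z \<and>
           runit K x \<cdot>\<^bsub>ho X\<^esub> (\<mu> x (unit_ob K) \<cdot>\<^bsub>ho X\<^esub> e) = idn (ho X) x)) \<and>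
      (\<forall>x \<in> ob K. \<forall>y \<in> ob K. \<forall>z \<in> ob K.
         \<exists>w \<in> cells (fib X p 3) 0.
         \<exists>\<rho>1 \<in> cocart_over X p (ptm 3 1 [1, 0, 0]) w x.
         \<exists>\<rho>2 \<in> cocart_over X p (ptm 3 1 [0, 1, 0]) w y.
         \<exists>\<rho>3 \<in> cocart_over X p (ptm 3 1 [0, 0, 1]) w z.
         \<exists>a \<in> arr_over X p (ptm 3 2 [1, 1, 2]) w (T (x \<boxtimes>\<^bsub>K\<^esub> y) z).
         \<exists>b \<in> arr_over X p (ptm 3 2 [1, 2, 0]) w (T x y).
         \<exists>c \<in> arr_over X p (ptm 3 2 [1, 2, 2]) w (T x (y \<boxtimes>\<^bsub>K\<^esub> z)).
         \<exists>d \<in> arr_over X p (ptm 3 2 [0, 1, 2]) w (T y z).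
           \<pi>1 x y \<cdot>\<^bsub>ho X\<^esub> b = \<rho>1 \<and> \<pi>2 x y \<cdot>\<^bsub>ho X\<^esub> b = \<rho>2 \<and>
           \<pi>1 (x \<boxtimes>\<^bsub>K\<^esub> y) z \<cdot>\<^bsub>ho X\<^esub> a = \<mu> x y \<cdot>\<^bsub>ho X\<^esub> b \<and> \<pi>2 (x \<boxtimes>\<^bsub>K\<^esub> y) z \<cdot>\<^bsub>ho X\<^esub> a = \<rho>3 \<and>
           \<pi>1 y z \<cdot>\<^bsub>ho X\<^esub> d = \<rho>2 \<and> \<pi>2 y z \<cdot>\<^bsub>ho X\<^esub> d = \<rho>3 \<and>
           \<pi>1 x (y \<boxtimes>\<^bsub>K\<^esub> z) \<cdot>\<^bsub>ho X\<^esub> c = \<rho>1 \<and> \<pi>2 x (y \<boxtimes>\<^bsub>K\<^esub> z) \<cdot>\<^bsub>ho X\<^esub> c = \<mu> y z \<cdot>\<^bsub>ho X\<^esub> d \<and>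
           assoc K x y z \<cdot>\<^bsub>ho X\<^esub> (\<mu> (x \<boxtimes>\<^bsub>K\<^esub> y) z \<cdot>\<^bsub>ho X\<^esub> a) =
             \<mu> x (y \<boxtimes>\<^bsub>K\<^esub> z) \<cdot>\<^bsub>ho X\<^esub> c))"

text \<open>The addition of arrows needs no condition: in an additive category it is determined by the
  underlying category.\<close>

definition homotopy_tt_category ::
    "'s sset \<Rightarrow> 's over_Fin \<Rightarrow> ('s, 's set, 'z) tt_cat_scheme \<Rightarrow> bool" where
  "homotopy_tt_category X p K \<longleftrightarrow> cat.truncate K = ho (fib X p 1) \<and>
     induced_triangulation (fib X p 1) K \<and> induced_monoidal X p K"

end

theory Submission
  imports Defs "HOL-Algebra.Ring_Divisibility"
begin

text \<open>The zero ideal is the unique closed point as soon as it is prime, so it suffices that a tensor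
  product of nonzero objects is nonzero. Up to a shift, a nonzero object \<open>a\<close> is a retract of an object
  built from cells of dimension at least \<open>0\<close> and has nonzero zeroth homotopy, which is moreover finitely
  generated. If \<open>a \<otimes> b = 0\<close>, coning off all but the last of the generators of \<open>a\<close> and of \<open>b\<close> one at a
  time gives objects whose bottom homotopy is cyclic and nonzero, and whose tensor product still has
  no zeroth homotopy, although by the Kuenneth formula in the lowest degree this group would be the
  tensor product of two nonzero cyclic modules over a local ring. A diagram chase
  with the two generators replaces the Kuenneth formula.\<close>

text \<open>Let R be the endomorphism ring of the unit. If the two bottom groups are R/I and R/J,
  their tensor product is R/(I + J), and it vanishes only if some i in I has 1 - i in J; in a local
  ring one of these two is a unit, so I or J is all of R. The chase constructs i directly by lifting
  arrows through triangles, so neither modules nor truncations are formed. Coning off a map from the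
  unit to a replaces the bottom group of a by a quotient. After tensoring with a connective b, the
  bottom group of the product is likewise replaced by a quotient, so its vanishing survives. Finite
  generation makes the process stop at a nonzero cyclic quotient, the role usually played by
  Nakayama's lemma. The other obstacle is that generation by the unit is stated through an
  intersection of thick subcategories, which gives no induction over dimension. That induction
  becomes available once objects with a suspension that is a retract of a cellular object are shown
  to form a thick subcategory; closure under cones requires sorting cells by dimension
  again.\<close>

section \<open>Categories\<close>

context category
begin

lemma homs_ob: "f \<in> homs C X Y \<Longrightarrow> X \<in> ob C \<and> Y \<in> ob C"
  using dm_ob cd_ob by (auto simp: homs_def)

section \<open>Retracts and isomorphisms\<close>

definition retr :: "'o \<Rightarrow> 'o \<Rightarrow> bool" where
  "retr X Y \<longleftrightarrow> (\<exists>s \<in> homs C X Y. \<exists>r \<in> homs C Y X. r \<cdot> s = idn C X)"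

definition isom :: "'o \<Rightarrow> 'o \<Rightarrow> bool" where
  "isom X Y \<longleftrightarrow> (\<exists>s \<in> homs C X Y. \<exists>r \<in> homs C Y X. r \<cdot> s = idn C X \<and> s \<cdot> r = idn C Y)"

lemma isom_retr: "isom X Y \<Longrightarrow> retr X Y"
  by (auto simp: isom_def retr_def)

lemma isom_sym: "isom X Y \<Longrightarrow> isom Y X"
  by (auto simp: isom_def)

lemma isom_ob: "isom X Y \<Longrightarrow> X \<in> ob C \<and> Y \<in> ob C"
  by (auto simp: isom_def dest: homs_ob)

lemma retr_ob: "retr X Y \<Longrightarrow> X \<in> ob C \<and> Y \<in> ob C"
  by (auto simp: retr_def dest: homs_ob)

lemma isom_refl: "X \<in> ob C \<Longrightarrow> isom X X"
  unfolding isom_def using idn_homs cmp_idn by blast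

lemma retr_refl: "X \<in> ob C \<Longrightarrow> retr X X"
  using isom_refl isom_retr by blast

lemma section_comp:
  assumes "s \<in> homs C X Y" "r \<in> homs C Y X" "r \<cdot> s = idn C X"
    and "s' \<in> homs C Y Z" "r' \<in> homs C Z Y" "r' \<cdot> s' = idn C Y"
  shows "(r \<cdot> r') \<cdot> (s' \<cdot> s) = idn C X"
proof -
  have "(r \<cdot> r') \<cdot> (s' \<cdot> s) = r \<cdot> (r' \<cdot> (s' \<cdot> s))"
    using assms by (blast intro: cmp_assoc cmp_homs)
  also have "r' \<cdot> (s' \<cdot> s) = (r' \<cdot> s') \<cdot> s"
    using assms cmp_assoc by metis
  finally show ?thesis using assms idn_cmp by simp
qed

lemma retr_trans:
  assumes "retr X Y" "retr Y Z"
  shows "retr X Z"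
proof -
  obtain s r where 1: "s \<in> homs C X Y" "r \<in> homs C Y X" "r \<cdot> s = idn C X"
    using assms by (auto simp: retr_def)
  obtain s' r' where 2: "s' \<in> homs C Y Z" "r' \<in> homs C Z Y" "r' \<cdot> s' = idn C Y"
    using assms by (auto simp: retr_def)
  show ?thesis
    unfolding retr_def
    using section_comp[OF 1 2] cmp_homs[OF 1(1) 2(1)] cmp_homs[OF 2(2) 1(2)] by blast
qed

lemma isom_trans:
  assumes "isom X Y" "isom Y Z"
  shows "isom X Z"
proof -
  obtain s r where 1: "s \<in> homs C X Y" "r \<in> homs C Y X" "r \<cdot> s = idn C X" "s \<cdot> r = idn C Y"
    using assms by (auto simp: isom_def)
  obtain s' r' where 2: "s' \<in> homs C Y Z" "r' \<in> homs C Z Y" "r' \<cdot> s' = idn C Y" "s' \<cdot> r' = idn C Z"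
    using assms by (auto simp: isom_def)
  show ?thesis
    unfolding isom_def
    using section_comp[OF 1(1-3) 2(1-3)] section_comp[OF 2(2,1,4) 1(2,1,4)]
      cmp_homs[OF 1(1) 2(1)] cmp_homs[OF 2(2) 1(2)] by blast
qed

lemma iso_arr_homs:
  "f \<in> homs C X Y \<Longrightarrow>
    iso_arr C f \<longleftrightarrow> (\<exists>g \<in> homs C Y X. g \<cdot> f = idn C X \<and> f \<cdot> g = idn C Y)"
  by (auto simp: iso_arr_def homs_def)

lemma iso_arr_isom: "f \<in> homs C X Y \<Longrightarrow> iso_arr C f \<Longrightarrow> isom X Y"
  by (auto simp: iso_arr_homs isom_def)

lemma iso_arr_idn: "X \<in> ob C \<Longrightarrow> iso_arr C (idn C X)"
  using idn_homs[of X] cmp_idn iso_arr_homs by blast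

text \<open>The left inverse \<open>l \<cdot> d\<close> and the right inverse
  \<open>d \<cdot> r\<close> of \<open>c\<close> coincide. Fill-ins of triangles are compared this
  way, since only their composites are seen to be invertible.\<close>

lemma isom_two_sided:
  assumes c: "c \<in> homs C X Y" and d: "d \<in> homs C Y X"
    and "iso_arr C (d \<cdot> c)" "iso_arr C (c \<cdot> d)"
  shows "isom X Y"
proof -
  obtain l where l: "l \<in> homs C X X" "l \<cdot> (d \<cdot> c) = idn C X"
    using assms iso_arr_homs[OF cmp_homs[OF c d]] by blast
  obtain r where r: "r \<in> homs C Y Y" "(c \<cdot> d) \<cdot> r = idn C Y"
    using assms iso_arr_homs[OF cmp_homs[OF d c]] by blast
  have ld: "l \<cdot> d \<in> homs C Y X" and dr: "d \<cdot> r \<in> homs C Y X"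
    using c d l r cmp_homs by blast+
  have 1: "(l \<cdot> d) \<cdot> c = idn C X" using cmp_assoc[OF c d l(1)] l by simp
  have 2: "c \<cdot> (d \<cdot> r) = idn C Y" using cmp_assoc[OF r(1) d c] r by simp
  have "l \<cdot> d = (l \<cdot> d) \<cdot> (c \<cdot> (d \<cdot> r))" using 2 cmp_idn[OF ld] by simp
  also have "\<dots> = ((l \<cdot> d) \<cdot> c) \<cdot> (d \<cdot> r)" using cmp_assoc[OF dr c ld] by simp
  also have "\<dots> = d \<cdot> r" using 1 idn_cmp[OF dr] by simp
  finally show ?thesis using 1 2 c ld isom_def by auto
qed

end

lemma endofunctor_retr:
  assumes "category C" "endofunctor C Fo Fa" "category.retr C X Y"
  shows "category.retr C (Fo X) (Fo Y)"
proof -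
  interpret category C by fact
  obtain s r where "s \<in> homs C X Y" "r \<in> homs C Y X" "r \<cdot>\<^bsub>C\<^esub> s = idn C X"
    using assms(3) by (auto simp: retr_def)
  with assms(2) homs_ob show ?thesis
    unfolding retr_def endofunctor_def by metis
qed

lemma endofunctor_isom:
  assumes "category C" "endofunctor C Fo Fa" "category.isom C X Y"
  shows "category.isom C (Fo X) (Fo Y)"
proof -
  interpret category C by fact
  obtain s r where "s \<in> homs C X Y" "r \<in> homs C Y X" "r \<cdot>\<^bsub>C\<^esub> s = idn C X"
    "s \<cdot>\<^bsub>C\<^esub> r = idn C Y"
    using assms(3) by (auto simp: isom_def)
  with assms(2) homs_ob show ?thesis
    unfolding isom_def endofunctor_def by metis
qed

section \<open>Additive categories\<close>

context additive_category
begin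

abbreviation madd (infixl "\<dotplus>" 65) where "f \<dotplus> g \<equiv> plus K f g"

lemma hom_group_monoid: "X \<in> ob K \<Longrightarrow> Y \<in> ob K \<Longrightarrow> Group.monoid (hom_group K X Y)"
  using hom_comm_group[of X Y] by (simp add: comm_group_def comm_monoid_def)

lemma nul_homs: "X \<in> ob K \<Longrightarrow> Y \<in> ob K \<Longrightarrow> nul K X Y \<in> homs K X Y"
  using monoid.one_closed[OF hom_group_monoid] by (simp add: hom_group_def)

lemma plus_homs: "f \<in> homs K X Y \<Longrightarrow> g \<in> homs K X Y \<Longrightarrow> f \<dotplus> g \<in> homs K X Y"
  using monoid.m_closed[OF hom_group_monoid, of X Y f g] homs_ob[of f X Y] by (simp add: hom_group_def)

lemma plus_assoc:
  "f \<in> homs K X Y \<Longrightarrow> g \<in> homs K X Y \<Longrightarrow> h \<in> homs K X Y \<Longrightarrow> (f \<dotplus> g) \<dotplus> h = f \<dotplus> (g \<dotplus> h)"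
  using monoid.m_assoc[OF hom_group_monoid, of X Y f g h] homs_ob[of f X Y] by (simp add: hom_group_def)

lemma plus_comm: "f \<in> homs K X Y \<Longrightarrow> g \<in> homs K X Y \<Longrightarrow> f \<dotplus> g = g \<dotplus> f"
  using hom_comm_group[of X Y] homs_ob[of f X Y] comm_monoid.m_comm[of "hom_group K X Y"]
  by (simp add: hom_group_def comm_group_def)

lemma nul_plus: "f \<in> homs K X Y \<Longrightarrow> nul K X Y \<dotplus> f = f"
  using hom_comm_group[of X Y] homs_ob[of f X Y] monoid.l_one[of "hom_group K X Y" f]
  by (simp add: hom_group_def comm_group_def comm_monoid_def)

lemma plus_nul: "f \<in> homs K X Y \<Longrightarrow> f \<dotplus> nul K X Y = f"
  using nul_plus plus_comm nul_homs homs_ob by metis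

lemma neg_homs: "f \<in> homs K X Y \<Longrightarrow> neg K f \<in> homs K X Y"
  using hom_comm_group[of X Y] homs_ob[of f X Y] group.inv_closed[of "hom_group K X Y" f]
  by (auto simp: hom_group_def neg_def homs_def comm_group_def)

lemma neg_plus: "f \<in> homs K X Y \<Longrightarrow> neg K f \<dotplus> f = nul K X Y"
  using hom_comm_group[of X Y] homs_ob[of f X Y] group.l_inv[of "hom_group K X Y" f]
  by (auto simp: hom_group_def neg_def homs_def comm_group_def)

lemma plus_neg: "f \<in> homs K X Y \<Longrightarrow> f \<dotplus> neg K f = nul K X Y"
  using neg_plus plus_comm neg_homs by metis

lemma neg_unique:
  assumes "f \<in> homs K X Y" "g \<in> homs K X Y" "f \<dotplus> g = nul K X Y"
  shows "g = neg K f"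
proof -
  have "g = (neg K f \<dotplus> f) \<dotplus> g" using assms neg_plus nul_plus by simp
  also have "\<dots> = neg K f \<dotplus> (f \<dotplus> g)" using assms neg_homs by (intro plus_assoc)
  finally show ?thesis using assms plus_nul neg_homs by simp
qed

text \<open>Composition and additive functors are only assumed to preserve sums; this turns that
  into preservation of zero arrows.\<close>

lemma plus_idem_nul:
  assumes "f \<in> homs K X Y" "f \<dotplus> f = f"
  shows "f = nul K X Y"
proof -
  have "f = (neg K f \<dotplus> f) \<dotplus> f" using assms neg_plus nul_plus by simp
  also have "\<dots> = neg K f \<dotplus> (f \<dotplus> f)" using assms neg_homs by (intro plus_assoc)
  finally show ?thesis using assms neg_plus by simp
qed

lemma neg_neg: "f \<in> homs K X Y \<Longrightarrow> neg K (neg K f) = f"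
  using neg_unique[of "neg K f" X Y f] neg_homs neg_plus by simp

lemma neg_nul: "X \<in> ob K \<Longrightarrow> Y \<in> ob K \<Longrightarrow> neg K (nul K X Y) = nul K X Y"
  using neg_unique[of "nul K X Y" X Y "nul K X Y"] nul_homs nul_plus by simp

lemma cmp_nul:
  assumes "X \<in> ob K" "g \<in> homs K Y Z"
  shows "g \<cdot> nul K X Y = nul K X Z"
proof -
  have n: "nul K X Y \<in> homs K X Y" using assms homs_ob nul_homs by blast
  then have "g \<cdot> nul K X Y \<dotplus> g \<cdot> nul K X Y = g \<cdot> nul K X Y"
    using cmp_plus_right[OF n n assms(2)] nul_plus[OF n] by simp
  then show ?thesis using plus_idem_nul cmp_homs[OF n assms(2)] by blast
qed

lemma nul_cmp:
  assumes "Z \<in> ob K" "g \<in> homs K X Y"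
  shows "nul K Y Z \<cdot> g = nul K X Z"
proof -
  have n: "nul K Y Z \<in> homs K Y Z" using assms homs_ob nul_homs by blast
  then have "nul K Y Z \<cdot> g \<dotplus> nul K Y Z \<cdot> g = nul K Y Z \<cdot> g"
    using cmp_plus_left[OF assms(2) n n] nul_plus[OF n] by simp
  then show ?thesis using plus_idem_nul cmp_homs[OF assms(2) n] by blast
qed

lemma neg_cmp:
  assumes "f \<in> homs K X Y" "g \<in> homs K Y Z"
  shows "neg K g \<cdot> f = neg K (g \<cdot> f)"
proof (rule neg_unique)
  show "g \<cdot> f \<in> homs K X Z" "neg K g \<cdot> f \<in> homs K X Z"
    using assms cmp_homs neg_homs by blast+
  show "g \<cdot> f \<dotplus> neg K g \<cdot> f = nul K X Z"
    using cmp_plus_left[OF assms(1) assms(2) neg_homs[OF assms(2)]] plus_neg[OF assms(2)]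
      nul_cmp assms homs_ob by metis
qed

lemma cmp_neg:
  assumes "f \<in> homs K X Y" "g \<in> homs K Y Z"
  shows "g \<cdot> neg K f = neg K (g \<cdot> f)"
proof (rule neg_unique)
  show "g \<cdot> f \<in> homs K X Z" "g \<cdot> neg K f \<in> homs K X Z"
    using assms cmp_homs neg_homs by blast+
  show "g \<cdot> f \<dotplus> g \<cdot> neg K f = nul K X Z"
    using cmp_plus_right[OF assms(1) neg_homs[OF assms(1)] assms(2)] plus_neg[OF assms(1)]
      cmp_nul assms homs_ob by metis
qed

section \<open>Vanishing Hom groups\<close>

definition hom0 :: "'o \<Rightarrow> 'o \<Rightarrow> bool" where
  "hom0 X Y \<longleftrightarrow> X \<in> ob K \<and> Y \<in> ob K \<and> (\<forall>f \<in> homs K X Y. f = nul K X Y)"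

lemma hom0_retr:
  assumes "hom0 X Y" "retr Y' Y"
  shows "hom0 X Y'"
proof -
  obtain s r where sr: "s \<in> homs K Y' Y" "r \<in> homs K Y Y'" "r \<cdot> s = idn K Y'"
    using assms by (auto simp: retr_def)
  have "f = nul K X Y'" if f: "f \<in> homs K X Y'" for f
  proof -
    have "f = r \<cdot> (s \<cdot> f)" using f sr cmp_assoc idn_cmp by metis
    also have "s \<cdot> f = nul K X Y" using assms f sr cmp_homs hom0_def by blast
    finally show ?thesis using cmp_nul sr assms hom0_def by metis
  qed
  then show ?thesis using assms retr_ob hom0_def by blast
qed

lemma hom0_retr_left:
  assumes "hom0 X Y" "retr X' X"
  shows "hom0 X' Y"
proof -
  obtain s r where sr: "s \<in> homs K X' X" "r \<in> homs K X X'" "r \<cdot> s = idn K X'"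
    using assms by (auto simp: retr_def)
  have "f = nul K X' Y" if f: "f \<in> homs K X' Y" for f
  proof -
    have "f = (f \<cdot> r) \<cdot> s" using f sr cmp_assoc cmp_idn by metis
    also have "f \<cdot> r = nul K X Y" using assms f sr cmp_homs hom0_def by blast
    finally show ?thesis using nul_cmp sr assms hom0_def by metis
  qed
  then show ?thesis using assms retr_ob hom0_def by blast
qed

lemma hom0_zero: "X \<in> ob K \<Longrightarrow> is_zero K Z \<Longrightarrow> hom0 X Z"
  unfolding hom0_def is_zero_def using nul_cmp idn_cmp by metis

lemma hom0_zero_left: "X \<in> ob K \<Longrightarrow> is_zero K Z \<Longrightarrow> hom0 Z X"
  unfolding hom0_def is_zero_def using cmp_nul cmp_idn by metis

lemma is_zero_hom0: "is_zero K Z \<longleftrightarrow> hom0 Z Z"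
  using hom0_zero[of Z Z] idn_homs unfolding hom0_def is_zero_def by blast

lemma is_zero_retr: "is_zero K Z \<Longrightarrow> retr X Z \<Longrightarrow> is_zero K X"
  using is_zero_hom0 hom0_retr hom0_retr_left by blast

end


section \<open>Triangulated categories\<close>

lemma endofunctor_ob: "endofunctor K Fo Fa \<Longrightarrow> X \<in> ob K \<Longrightarrow> Fo X \<in> ob K"
  by (simp add: endofunctor_def)

lemma endofunctor_idn: "endofunctor K Fo Fa \<Longrightarrow> X \<in> ob K \<Longrightarrow> Fa (idn K X) = idn K (Fo X)"
  by (simp add: endofunctor_def)

lemma endofunctor_homs: "endofunctor K Fo Fa \<Longrightarrow> f \<in> homs K X Y \<Longrightarrow> Fa f \<in> homs K (Fo X) (Fo Y)"
  by (simp add: endofunctor_def)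

lemma endofunctor_cmp:
  "endofunctor K Fo Fa \<Longrightarrow> f \<in> homs K X Y \<Longrightarrow> g \<in> homs K Y Z \<Longrightarrow>
    Fa (g \<cdot>\<^bsub>K\<^esub> f) = Fa g \<cdot>\<^bsub>K\<^esub> Fa f"
  unfolding endofunctor_def by blast

context additive_category
begin

lemma is_zero_ob: "is_zero K Z \<Longrightarrow> Z \<in> ob K"
  by (simp add: is_zero_def)

lemma additive_endofunctor_nul:
  assumes "additive_endofunctor K Fo Fa" "X \<in> ob K" "Y \<in> ob K"
  shows "Fa (nul K X Y) = nul K (Fo X) (Fo Y)"
proof -
  have n: "nul K X Y \<in> homs K X Y" using assms nul_homs by blast
  have "Fa (nul K X Y) \<in> homs K (Fo X) (Fo Y)"
    using assms n endofunctor_homs additive_endofunctor_def by metis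
  moreover have "Fa (nul K X Y) \<dotplus> Fa (nul K X Y) = Fa (nul K X Y)"
    using assms n nul_plus[OF n] unfolding additive_endofunctor_def by metis
  ultimately show ?thesis using plus_idem_nul by blast
qed

lemma additive_endofunctor_zero:
  assumes "additive_endofunctor K Fo Fa" "is_zero K Z"
  shows "is_zero K (Fo Z)"
  using assms additive_endofunctor_nul[OF assms(1), of Z Z] endofunctor_idn[of K Fo Fa Z]
    endofunctor_ob[of K Fo Fa Z]
  by (simp add: is_zero_def additive_endofunctor_def)

end

context triangulated_category
begin

abbreviation S :: "'a \<Rightarrow> 'a" where "S \<equiv> suspO K"
abbreviation SA :: "'b \<Rightarrow> 'b" where "SA \<equiv> suspA K"

section \<open>The suspension as an equivalence\<close>

lemma S_endofunctor: "endofunctor K S SA"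
  using susp_additive additive_endofunctor_def by blast

lemmas S_ob = endofunctor_ob[OF S_endofunctor]
  and S_idn = endofunctor_idn[OF S_endofunctor]
  and S_homs = endofunctor_homs[OF S_endofunctor]
  and S_cmp = endofunctor_cmp[OF S_endofunctor]
  and S_nul = additive_endofunctor_nul[OF susp_additive]
  and S_zero = additive_endofunctor_zero[OF susp_additive]
  and S_retr = endofunctor_retr[OF category_axioms S_endofunctor]
  and S_isom = endofunctor_isom[OF category_axioms S_endofunctor]

lemma S_bij: "X \<in> ob K \<Longrightarrow> Y \<in> ob K \<Longrightarrow> bij_betw SA (homs K X Y) (homs K (S X) (S Y))"
  using susp_equivalence autoequivalence_def by metis

lemma S_full:
  assumes "h \<in> homs K (S X) (S Y)" "X \<in> ob K" "Y \<in> ob K"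
  obtains f where "f \<in> homs K X Y" "SA f = h"
  using assms(1) bij_betw_imp_surj_on[OF S_bij[OF assms(2,3)]] that by (metis imageE)

lemma S_faithful: "f \<in> homs K X Y \<Longrightarrow> g \<in> homs K X Y \<Longrightarrow> SA f = SA g \<Longrightarrow> f = g"
  using homs_ob[of f X Y] inj_onD[OF bij_betw_imp_inj_on[OF S_bij[of X Y]]] by blast

lemma desuspend:
  assumes "Y \<in> ob K"
  obtains X where "X \<in> ob K" "isom Y (S X)"
proof -
  obtain X f where "X \<in> ob K" "f \<in> homs K (S X) Y" "iso_arr K f"
    using assms susp_equivalence unfolding autoequivalence_def by blast
  then show ?thesis using that iso_arr_isom isom_sym by blast
qed

lemma S_section:
  assumes "s \<in> homs K X Y" "r \<in> homs K Y X" "SA r \<cdot> SA s = idn K (S X)"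
  shows "r \<cdot> s = idn K X"
proof (rule S_faithful)
  show "r \<cdot> s \<in> homs K X X" "idn K X \<in> homs K X X"
    using assms cmp_homs idn_homs homs_ob by blast+
  show "SA (r \<cdot> s) = SA (idn K X)"
    using assms S_cmp S_idn homs_ob by metis
qed

lemma S_retr_cancel:
  assumes "retr (S X) (S Y)" "X \<in> ob K" "Y \<in> ob K"
  shows "retr X Y"
proof -
  obtain s' r' where 1: "s' \<in> homs K (S X) (S Y)" "r' \<in> homs K (S Y) (S X)" "r' \<cdot> s' = idn K (S X)"
    using assms by (auto simp: retr_def)
  obtain s where s: "s \<in> homs K X Y" "SA s = s'" using S_full[OF 1(1) assms(2,3)] .
  obtain r where r: "r \<in> homs K Y X" "SA r = r'" using S_full[OF 1(2) assms(3,2)] .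
  show ?thesis unfolding retr_def using s r S_section 1 by blast
qed

lemma S_isom_cancel:
  assumes "isom (S X) (S Y)" "X \<in> ob K" "Y \<in> ob K"
  shows "isom X Y"
proof -
  obtain s' r' where 1: "s' \<in> homs K (S X) (S Y)" "r' \<in> homs K (S Y) (S X)"
    "r' \<cdot> s' = idn K (S X)" "s' \<cdot> r' = idn K (S Y)"
    using assms by (auto simp: isom_def)
  obtain s where s: "s \<in> homs K X Y" "SA s = s'" using S_full[OF 1(1) assms(2,3)] .
  obtain r where r: "r \<in> homs K Y X" "SA r = r'" using S_full[OF 1(2) assms(3,2)] .
  show ?thesis unfolding isom_def using s r S_section 1 by blast
qed

lemma hom0_S: "X \<in> ob K \<Longrightarrow> Y \<in> ob K \<Longrightarrow> hom0 (S X) (S Y) \<longleftrightarrow> hom0 X Y"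
  unfolding hom0_def using S_full[of _ X Y] S_faithful S_homs S_nul S_ob nul_homs by metis

lemma S_zero_iff: "X \<in> ob K \<Longrightarrow> is_zero K (S X) \<longleftrightarrow> is_zero K X"
  by (simp add: is_zero_hom0 hom0_S)

abbreviation Sn :: "nat \<Rightarrow> 'a \<Rightarrow> 'a" where "Sn n \<equiv> S ^^ n"

lemma Sn_ob: "X \<in> ob K \<Longrightarrow> Sn n X \<in> ob K"
  by (induction n) (auto intro: S_ob)

lemma Sn_retr: "retr X Y \<Longrightarrow> retr (Sn n X) (Sn n Y)"
  by (induction n) (auto intro: S_retr)

lemma hom0_Sn: "X \<in> ob K \<Longrightarrow> Y \<in> ob K \<Longrightarrow> hom0 (Sn n X) (Sn n Y) \<longleftrightarrow> hom0 X Y"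
  by (induction n) (auto simp: hom0_S Sn_ob)

lemma Sn_zero_iff: "X \<in> ob K \<Longrightarrow> is_zero K (Sn n X) \<longleftrightarrow> is_zero K X"
  by (simp add: is_zero_hom0 hom0_Sn)

lemma Sn_isom_cancel: "isom (Sn n X) (Sn n Y) \<Longrightarrow> X \<in> ob K \<Longrightarrow> Y \<in> ob K \<Longrightarrow> isom X Y"
  by (induction n) (auto dest: S_isom_cancel simp: Sn_ob)


subsection \<open>Triangles\<close>

definition tri :: "'a \<Rightarrow> 'a \<Rightarrow> 'a \<Rightarrow> 'b \<Rightarrow> 'b \<Rightarrow> 'b \<Rightarrow> bool" where
  "tri X Y Z f g h \<longleftrightarrow> f \<in> homs K X Y \<and> g \<in> homs K Y Z \<and> h \<in> homs K Z (S X) \<and> (f, g, h) \<in> dist K"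

lemma triD:
  assumes "tri X Y Z f g h"
  shows "f \<in> homs K X Y" "g \<in> homs K Y Z" "h \<in> homs K Z (S X)" "(f, g, h) \<in> dist K"
    and "X \<in> ob K" "Y \<in> ob K" "Z \<in> ob K"
  using assms homs_ob by (auto simp: tri_def)

lemma dist_tri: "(f, g, h) \<in> dist K \<Longrightarrow> tri (dm K f) (dm K g) (dm K h) f g h"
  using dist_homs[of f g h] unfolding tri_def homs_def mem_Collect_eq by metis

lemma tri_rotate:
  "f \<in> homs K X Y \<Longrightarrow> g \<in> homs K Y Z \<Longrightarrow> h \<in> homs K Z (S X) \<Longrightarrow>
    tri Y Z (S X) g h (neg K (SA f)) \<longleftrightarrow> tri X Y Z f g h"
  using dist_rotate[of f X Y g Z h] neg_homs[OF S_homs] by (auto simp: tri_def)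

lemma tri_rot: "tri X Y Z f g h \<Longrightarrow> tri Y Z (S X) g h (neg K (SA f))"
  using tri_rotate[of f X Y g Z h] triD(1-3)[of X Y Z f g h] by simp

lemma tri_cone: "f \<in> homs K X Y \<Longrightarrow> \<exists>Z g h. tri X Y Z f g h"
  using dist_cone[of f] dist_tri dist_homs unfolding homs_def mem_Collect_eq by metis

lemma tri_idn: "X \<in> ob K \<Longrightarrow> is_zero K Z \<Longrightarrow> tri X X Z (idn K X) (nul K X Z) (nul K Z (S X))"
  unfolding tri_def using dist_idn idn_homs nul_homs S_ob is_zero_ob by metis

lemma tri_idn':
  assumes "X \<in> ob K" "is_zero K Z"
  shows "tri Z X X (nul K Z X) (idn K X) (nul K X (S Z))"
proof -
  have Z: "Z \<in> ob K" using assms is_zero_ob by blast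
  have "tri X X (S Z) (idn K X) (nul K X (S Z)) (nul K (S Z) (S X))"
    using tri_idn assms S_zero by blast
  moreover have "neg K (SA (nul K Z X)) = nul K (S Z) (S X)"
    using S_nul[OF Z assms(1)] neg_nul[OF S_ob[OF Z] S_ob[OF assms(1)]] by simp
  ultimately show ?thesis
    using tri_rotate[OF nul_homs[OF Z assms(1)] idn_homs[OF assms(1)] nul_homs[OF assms(1) S_ob[OF Z]]]
    by simp
qed

lemma tri_fill:
  assumes "tri X Y Z f g h" "tri X' Y' Z' f' g' h'"
    and "a \<in> homs K X X'" "b \<in> homs K Y Y'" "b \<cdot> f = f' \<cdot> a"
  obtains c where "c \<in> homs K Z Z'" "c \<cdot> g = g' \<cdot> b" "SA a \<cdot> h = h' \<cdot> c"
  using dist_fill[of f g h f' g' h' a b] assms that by (auto simp: tri_def homs_def)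

lemma tri_isom:
  assumes "tri X Y Z f g h" "f' \<in> homs K X' Y'" "g' \<in> homs K Y' Z'" "h' \<in> homs K Z' (S X')"
    and "a \<in> homs K X X'" "b \<in> homs K Y Y'" "c \<in> homs K Z Z'"
    and "iso_arr K a" "iso_arr K b" "iso_arr K c"
    and "b \<cdot> f = f' \<cdot> a" "c \<cdot> g = g' \<cdot> b" "SA a \<cdot> h = h' \<cdot> c"
  shows "tri X' Y' Z' f' g' h'"
  unfolding tri_def
  using assms dist_iso[of f g h f' X' Y' g' Z' h' a b c] by (auto simp: tri_def homs_def)

section \<open>Weak kernels and cokernels in triangles\<close>

lemma tri_comp_nul:
  assumes "tri X Y Z f g h"
  shows "g \<cdot> f = nul K X Z"
proof -
  obtain Z0 where Z0: "is_zero K Z0" using zero_object by blast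
  note t = triD[OF assms]
  \<comment> \<open>The triangle on the identity of \<open>X\<close> is mapped to the given one by
    the identity and \<open>f\<close>; thus \<open>g \<cdot> f\<close> factors through the zero
    object \<open>Z0\<close>.\<close>
  obtain c where c: "c \<in> homs K Z0 Z" "c \<cdot> nul K X Z0 = g \<cdot> f"
    using tri_fill[OF tri_idn[OF t(5) Z0] assms idn_homs[OF t(5)] t(1)] by metis
  then show ?thesis using cmp_nul[OF t(5) c(1)] by simp
qed

lemma tri_comp_nul': "tri X Y Z f g h \<Longrightarrow> h \<cdot> g = nul K Y (S X)"
  using tri_comp_nul tri_rot by blast

text \<open>Exactness of Hom(L, -) at \<open>Y\<close>. A fill-in produces the third arrow, so
  \<open>u\<close> has to become the first one: L -> 0 -> S L is mapped to the rotated triangle Y ->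
  Z -> S X, and the resulting arrow S L -> S X is desuspended. The signs of the two rotations
  cancel.\<close>

lemma weak_kernel:
  assumes "tri X Y Z f g h" "u \<in> homs K L Y" "g \<cdot> u = nul K L Z"
  obtains u' where "u' \<in> homs K L X" "f \<cdot> u' = u"
proof -
  note t = triD[OF assms(1)]
  have L: "L \<in> ob K" using assms homs_ob by blast
  obtain Z0 where Z0: "is_zero K Z0" using zero_object by blast
  then have Z0': "Z0 \<in> ob K" using is_zero_ob by blast
  have 1: "tri L Z0 (S L) (nul K L Z0) (nul K Z0 (S L)) (neg K (SA (idn K L)))"
    using tri_rot[OF tri_idn[OF L Z0]] .
  have n: "nul K Z0 Z \<in> homs K Z0 Z" using nul_homs Z0' t by blast
  have "nul K Z0 Z \<cdot> nul K L Z0 = g \<cdot> u" using assms cmp_nul[OF L n] by simp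
  from tri_fill[OF 1 tri_rot[OF assms(1)] assms(2) n this]
  obtain c where c: "c \<in> homs K (S L) (S X)" "SA u \<cdot> neg K (SA (idn K L)) = neg K (SA f) \<cdot> c"
    by blast
  obtain u' where u': "u' \<in> homs K L X" "SA u' = c" using S_full[OF c(1) L t(5)] .
  have fu: "f \<cdot> u' \<in> homs K L Y" using u' t cmp_homs by blast
  have Su: "SA u \<in> homs K (S L) (S Y)" "SA f \<in> homs K (S X) (S Y)" using assms t S_homs by blast+
  have "neg K (SA u) = SA u \<cdot> neg K (SA (idn K L))"
    using cmp_neg[OF idn_homs[OF S_ob[OF L]] Su(1)] cmp_idn[OF Su(1)] S_idn[OF L] by simp
  also have "\<dots> = neg K (SA (f \<cdot> u'))"
    using c u' neg_cmp[OF c(1) Su(2)] S_cmp[OF u'(1) t(1)] by simp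
  finally have "SA u = SA (f \<cdot> u')" using neg_neg Su(1) S_homs[OF fu] by metis
  then show ?thesis using that u' S_faithful[OF assms(2) fu] by simp
qed

lemma weak_kernel':
  assumes "tri X Y Z f g h" "u \<in> homs K L Z" "h \<cdot> u = nul K L (S X)"
  obtains u' where "u' \<in> homs K L Y" "g \<cdot> u' = u"
  using weak_kernel[OF tri_rot[OF assms(1)] assms(2,3)] .

text \<open>Mapping the triangle to 0 -> L -> L by zero and \<open>v\<close> yields the
  factorization as the fill-in itself, without desuspension.\<close>

lemma weak_cokernel:
  assumes "tri X Y Z f g h" "v \<in> homs K Y L" "v \<cdot> f = nul K X L"
  obtains v' where "v' \<in> homs K Z L" "v' \<cdot> g = v"
proof -
  note t = triD[OF assms(1)]
  have L: "L \<in> ob K" using assms homs_ob by blast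
  obtain Z0 where Z0: "is_zero K Z0" using zero_object by blast
  then have Z0': "Z0 \<in> ob K" using is_zero_ob by blast
  have n: "nul K X Z0 \<in> homs K X Z0" "nul K Z0 L \<in> homs K Z0 L" using nul_homs Z0' t L by blast+
  have "v \<cdot> f = nul K Z0 L \<cdot> nul K X Z0" using assms cmp_nul[OF t(5) n(2)] by simp
  from tri_fill[OF assms(1) tri_idn'[OF L Z0] n(1) assms(2) this]
  obtain c where "c \<in> homs K Z L" "c \<cdot> g = idn K L \<cdot> v" by blast
  then show ?thesis using that idn_cmp assms(2) by simp
qed

lemma weak_cokernel':
  assumes "tri X Y Z f g h" "v \<in> homs K Z L" "v \<cdot> g = nul K Y L"
  obtains v' where "v' \<in> homs K (S X) L" "v' \<cdot> h = v"
  using weak_cokernel[OF tri_rot[OF assms(1)] assms(2,3)] .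

text \<open>The difference \<open>n\<close> of \<open>c\<close> and the identity kills
  \<open>g\<close>, hence factors through \<open>h\<close>, and is itself killed by
  \<open>h\<close>. So \<open>n\<close> squares to zero, and the inverse of 1 + n is 1 - n. Fill-ins
  are not unique, so \<open>c\<close> need not be the identity.\<close>

lemma cone_endo_iso:
  assumes "tri X Y Z f g h" "c \<in> homs K Z Z" "c \<cdot> g = g" "h \<cdot> c = h"
  shows "iso_arr K c"
proof -
  note t = triD[OF assms(1)]
  define i where "i = idn K Z"
  have i: "i \<in> homs K Z Z" using idn_homs t i_def by blast
  define n where "n = c \<dotplus> neg K i"
  have n: "n \<in> homs K Z Z" using n_def assms i plus_homs neg_homs by blast
  have "n \<cdot> g = c \<cdot> g \<dotplus> neg K i \<cdot> g"
    unfolding n_def using cmp_plus_left t assms i neg_homs by blast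
  also have "\<dots> = nul K Y Z"
    using assms neg_cmp[OF t(2) i] idn_cmp[OF t(2)] plus_neg[OF t(2)] i_def by simp
  finally have ng: "n \<cdot> g = nul K Y Z" .
  have "h \<cdot> n = h \<cdot> c \<dotplus> h \<cdot> neg K i"
    unfolding n_def using cmp_plus_right t assms i neg_homs by blast
  also have "\<dots> = nul K Z (S X)"
    using assms cmp_neg[OF i t(3)] cmp_idn[OF t(3)] plus_neg[OF t(3)] i_def by simp
  finally have hn: "h \<cdot> n = nul K Z (S X)" .
  obtain v where v: "v \<in> homs K (S X) Z" "v \<cdot> h = n" using weak_cokernel'[OF assms(1) n ng] .
  have "n \<cdot> n = v \<cdot> (h \<cdot> n)" using cmp_assoc[OF n t(3) v(1)] v by simp
  also have "\<dots> = nul K Z Z" using hn cmp_nul t v by simp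
  finally have nn: "n \<cdot> n = nul K Z Z" .
  have c: "c = i \<dotplus> n"
  proof -
    have "i \<dotplus> n = (c \<dotplus> neg K i) \<dotplus> i" using plus_comm[OF i n] n_def by simp
    also have "\<dots> = c \<dotplus> (neg K i \<dotplus> i)" using assms i neg_homs plus_assoc by blast
    finally show ?thesis using neg_plus[OF i] plus_nul assms by simp
  qed
  define d where "d = i \<dotplus> neg K n"
  have d: "d \<in> homs K Z Z" using d_def n i plus_homs neg_homs by blast
  have idl: "i \<cdot> w = w" "w \<cdot> i = w" if "w \<in> homs K Z Z" for w
    using that idn_cmp cmp_idn i_def by auto
  have "d \<cdot> c = i \<cdot> c \<dotplus> neg K n \<cdot> c"
    unfolding d_def using cmp_plus_left assms i n neg_homs by blast
  also have "neg K n \<cdot> c = neg K n \<cdot> i \<dotplus> neg K n \<cdot> n"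
    unfolding c using cmp_plus_right n i neg_homs by blast
  also have "\<dots> = neg K n"
    using n nn idl neg_homs[OF n] neg_cmp[OF n n] neg_nul t plus_nul by simp
  also have "i \<cdot> c = c" using idl assms by simp
  also have "c \<dotplus> neg K n = i"
    unfolding c using plus_assoc[OF i n neg_homs[OF n]] plus_neg[OF n] plus_nul[OF i] by simp
  finally have dc: "d \<cdot> c = i" .
  have "c \<cdot> d = c \<cdot> i \<dotplus> c \<cdot> neg K n"
    unfolding d_def using cmp_plus_right assms i n neg_homs by blast
  also have "c \<cdot> neg K n = i \<cdot> neg K n \<dotplus> n \<cdot> neg K n"
    unfolding c using cmp_plus_left n i neg_homs by blast
  also have "\<dots> = neg K n"
    using n nn idl neg_homs[OF n] cmp_neg[OF n n] neg_nul t plus_nul by simp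
  also have "c \<cdot> i = c" using idl assms by simp
  also have "c \<dotplus> neg K n = i"
    unfolding c using plus_assoc[OF i n neg_homs[OF n]] plus_neg[OF n] plus_nul[OF i] by simp
  finally have "c \<cdot> d = i" .
  then show ?thesis using dc d iso_arr_homs[OF assms(2)] unfolding i_def by blast
qed

text \<open>The composite of the fill-ins in the two directions is compatible with the identities of
  \<open>X\<close> and \<open>Y\<close>. This does not make it the identity of \<open>Z\<close>, but
  \<open>cone_endo_iso\<close> makes it invertible.\<close>

lemma cone_retr:
  assumes t: "tri X Y Z f g h" and t': "tri X' Y' Z' f' g' h'"
    and s: "s \<in> homs K X X'" and r: "r \<in> homs K X' X" and rs: "r \<cdot> s = idn K X"
    and s': "s' \<in> homs K Y Y'" and r': "r' \<in> homs K Y' Y" and rs': "r' \<cdot> s' = idn K Y"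
    and sf: "s' \<cdot> f = f' \<cdot> s" and rf: "r' \<cdot> f' = f \<cdot> r"
  obtains c d where "c \<in> homs K Z Z'" "d \<in> homs K Z' Z" "iso_arr K (d \<cdot> c)"
proof -
  note T = triD[OF t] and T' = triD[OF t']
  obtain c where c: "c \<in> homs K Z Z'" "c \<cdot> g = g' \<cdot> s'" "SA s \<cdot> h = h' \<cdot> c"
    using tri_fill[OF t t' s s' sf] .
  obtain d where d: "d \<in> homs K Z' Z" "d \<cdot> g' = g \<cdot> r'" "SA r \<cdot> h' = h \<cdot> d"
    using tri_fill[OF t' t r r' rf] .
  have "(d \<cdot> c) \<cdot> g = d \<cdot> (g' \<cdot> s')" using cmp_assoc[OF T(2) c(1) d(1)] c by simp
  also have "\<dots> = (g \<cdot> r') \<cdot> s'" using cmp_assoc[OF s' T'(2) d(1)] d by simp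
  also have "\<dots> = g" using cmp_assoc[OF s' r' T(2)] rs' cmp_idn[OF T(2)] by simp
  finally have 1: "(d \<cdot> c) \<cdot> g = g" .
  have "h \<cdot> (d \<cdot> c) = (SA r \<cdot> h') \<cdot> c" using cmp_assoc[OF c(1) d(1) T(3)] d by simp
  also have "\<dots> = SA r \<cdot> (SA s \<cdot> h)" using cmp_assoc[OF c(1) T'(3) S_homs[OF r]] c by simp
  also have "\<dots> = SA (r \<cdot> s) \<cdot> h"
    using cmp_assoc[OF T(3) S_homs[OF s] S_homs[OF r]] S_cmp[OF s r] by simp
  also have "\<dots> = h" using rs S_idn T idn_cmp by simp
  finally have "iso_arr K (d \<cdot> c)" using cone_endo_iso[OF t _ 1] cmp_homs[OF c(1) d(1)] by blast
  then show ?thesis using that c d by blast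
qed

lemma iso_comp_retr:
  assumes "c \<in> homs K X Y" "d \<in> homs K Y X" "iso_arr K (d \<cdot> c)"
  shows "retr X Y"
proof -
  obtain l where l: "l \<in> homs K X X" "l \<cdot> (d \<cdot> c) = idn K X"
    using assms iso_arr_homs[OF cmp_homs[OF assms(1,2)]] by blast
  then have "(l \<cdot> d) \<cdot> c = idn K X" using cmp_assoc[OF assms(1,2) l(1)] by simp
  then show ?thesis unfolding retr_def using assms cmp_homs[OF assms(2) l(1)] by blast
qed

lemma cone_unique:
  assumes t: "tri X Y Z f g h" and t': "tri X Y Z' f g' h'"
  shows "isom Z Z'"
proof -
  note T = triD[OF t] and T' = triD[OF t']
  have X: "idn K X \<in> homs K X X" "idn K Y \<in> homs K Y Y" using T idn_homs by auto
  have e: "idn K Y \<cdot> f = f \<cdot> idn K X" using T idn_cmp cmp_idn by metis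
  obtain c where c: "c \<in> homs K Z Z'" "c \<cdot> g = g' \<cdot> idn K Y" "SA (idn K X) \<cdot> h = h' \<cdot> c"
    using tri_fill[OF t t' X e] .
  obtain d where d: "d \<in> homs K Z' Z" "d \<cdot> g' = g \<cdot> idn K Y" "SA (idn K X) \<cdot> h' = h \<cdot> d"
    using tri_fill[OF t' t X e] .
  have e: "c \<cdot> g = g'" "d \<cdot> g' = g" "h' \<cdot> c = h" "h \<cdot> d = h'"
    using c d T T' cmp_idn idn_cmp S_idn by metis+
  have "iso_arr K (d \<cdot> c)"
    using cone_endo_iso[OF t cmp_homs[OF c(1) d(1)]] e cmp_assoc[OF T(2) c(1) d(1)]
      cmp_assoc[OF c(1) d(1) T(3)] by simp
  moreover have "iso_arr K (c \<cdot> d)"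
    using cone_endo_iso[OF t' cmp_homs[OF d(1) c(1)]] e cmp_assoc[OF T'(2) d(1) c(1)]
      cmp_assoc[OF d(1) c(1) T'(3)] by simp
  ultimately show ?thesis using isom_two_sided c d by blast
qed

lemma fiber_unique:
  assumes "tri X Y Z f g h" "tri X Y' Z f' g' h"
  shows "isom Y Y'"
  using cone_unique[OF tri_rot[OF tri_rot[OF assms(1)]] tri_rot[OF tri_rot[OF assms(2)]]]
    S_isom_cancel triD[OF assms(1)] triD[OF assms(2)] by blast

lemma tri_S:
  assumes "tri X Y Z f g h"
  shows "tri (S X) (S Y) (S Z) (neg K (SA f)) (neg K (SA g)) (neg K (SA h))"
  using tri_rot[OF tri_rot[OF tri_rot[OF assms]]] .

lemma cmp_cancel:
  assumes "w \<in> homs K X Y" "a \<in> homs K X X'" "a' \<in> homs K X' X" "a' \<cdot> a = idn K X"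
  shows "(w \<cdot> a') \<cdot> a = w"
  using assms cmp_assoc[OF assms(2,3,1)] cmp_idn by simp

text \<open>A cone of \<open>h\<close> gives a triangle beginning with \<open>h\<close>, which has
  to be rotated back twice. Its third object is first replaced by an isomorphic suspension
  \<open>S Y\<close>. The arrows \<open>f\<close> and \<open>g\<close> are desuspended with a minus
  sign that the signs of the rotations undo.\<close>

lemma tri_of_third:
  assumes h: "h \<in> homs K Z (S X)" and X: "X \<in> ob K"
  obtains Y f g where "tri X Y Z f g h"
proof -
  have Z: "Z \<in> ob K" using h homs_ob by blast
  obtain C u v where t: "tri Z (S X) C h u v" using tri_cone[OF h] by blast
  note T = triD[OF t]
  obtain Y where Y: "Y \<in> ob K" "isom C (S Y)" using desuspend T by blast
  then obtain c c' where c: "c \<in> homs K C (S Y)" "c' \<in> homs K (S Y) C" "c' \<cdot> c = idn K C"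
    "c \<cdot> c' = idn K (S Y)" by (auto simp: isom_def)
  have cu: "c \<cdot> u \<in> homs K (S X) (S Y)" and vc: "v \<cdot> c' \<in> homs K (S Y) (S Z)"
    using c T cmp_homs by blast+
  obtain f where f: "f \<in> homs K X Y" "SA f = neg K (c \<cdot> u)" using S_full[OF neg_homs[OF cu] X Y(1)] .
  obtain g where g: "g \<in> homs K Y Z" "SA g = neg K (v \<cdot> c')" using S_full[OF neg_homs[OF vc] Y(1) Z] .
  have n: "neg K (SA f) = c \<cdot> u" "neg K (SA g) = v \<cdot> c'" using f g cu vc neg_neg by simp_all
  have i: "iso_arr K (idn K Z)" "iso_arr K (idn K (S X))" "iso_arr K c"
    using iso_arr_idn T c iso_arr_homs[OF c(1)] by blast+
  have "idn K (S X) \<cdot> h = h \<cdot> idn K Z" "c \<cdot> u = (c \<cdot> u) \<cdot> idn K (S X)"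
    "SA (idn K Z) \<cdot> v = (v \<cdot> c') \<cdot> c"
    using idn_cmp[OF h] cmp_idn[OF h] cmp_idn[OF cu] cmp_cancel[OF T(3) c(1-3)] S_idn[OF Z]
      idn_cmp[OF T(3)] by simp_all
  from tri_isom[OF t h cu vc idn_homs[OF Z] idn_homs[OF S_ob[OF X]] c(1) i this]
  have "tri Z (S X) (S Y) h (neg K (SA f)) (neg K (SA g))" using n by simp
  then have "tri Y Z (S X) g h (neg K (SA f))"
    using tri_rotate[OF g(1) h] cu n by simp
  then have "tri X Y Z f g h" using tri_rotate[OF f(1) g(1) h] by simp
  then show ?thesis using that by blast
qed

lemma tri_fiber:
  assumes t: "tri X Y Z f g h"
  obtains W d g' where "tri W X Y d f g'" "isom Z (S W)"
proof -
  note T = triD[OF t]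
  obtain W where W: "W \<in> ob K" "isom Z (S W)" using desuspend T by blast
  then obtain c c' where c: "c \<in> homs K Z (S W)" "c' \<in> homs K (S W) Z" "c' \<cdot> c = idn K Z"
    "c \<cdot> c' = idn K (S W)" by (auto simp: isom_def)
  have cg: "c \<cdot> g \<in> homs K Y (S W)" and hc: "h \<cdot> c' \<in> homs K (S W) (S X)"
    using c T cmp_homs by blast+
  obtain d where d: "d \<in> homs K W X" "SA d = neg K (h \<cdot> c')"
    using S_full[OF neg_homs[OF hc] W(1) T(5)] .
  have n: "neg K (SA d) = h \<cdot> c'" using d hc neg_neg by simp
  have i: "iso_arr K (idn K X)" "iso_arr K (idn K Y)" "iso_arr K c"
    using iso_arr_idn T c iso_arr_homs[OF c(1)] by blast+
  have "idn K Y \<cdot> f = f \<cdot> idn K X" "c \<cdot> g = (c \<cdot> g) \<cdot> idn K Y"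
    "SA (idn K X) \<cdot> h = (h \<cdot> c') \<cdot> c"
    using idn_cmp[OF T(1)] cmp_idn[OF T(1)] cmp_idn[OF cg] cmp_cancel[OF T(3) c(1-3)]
      S_idn[OF T(5)] idn_cmp[OF T(3)] by simp_all
  from tri_isom[OF t T(1) cg hc idn_homs[OF T(5)] idn_homs[OF T(6)] c(1) i this]
  have "tri X Y (S W) f (c \<cdot> g) (neg K (SA d))" using n by simp
  then have "tri W X Y d f (c \<cdot> g)" using tri_rotate[OF d(1) T(1) cg] by simp
  then show ?thesis using that W by blast
qed

text \<open>Forgetting the arrows of a triangle makes rotation free of signs and lets objects be
  replaced by isomorphic ones, see \<open>ext_rot\<close> and \<open>ext_isom\<close>.\<close>

definition ext :: "'a \<Rightarrow> 'a \<Rightarrow> 'a \<Rightarrow> bool" where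
  "ext X Y Z \<longleftrightarrow> (\<exists>f g h. tri X Y Z f g h)"

lemma extI: "tri X Y Z f g h \<Longrightarrow> ext X Y Z"
  unfolding ext_def by blast

lemma ext_ob: "ext X Y Z \<Longrightarrow> X \<in> ob K \<and> Y \<in> ob K \<and> Z \<in> ob K"
  unfolding ext_def by (auto dest: triD)

lemma ext_isom:
  assumes "ext X Y Z" "isom X X'" "isom Y Y'" "isom Z Z'"
  shows "ext X' Y' Z'"
proof -
  obtain f g h where t: "tri X Y Z f g h" using assms ext_def by blast
  note T = triD[OF t]
  obtain a a' where a: "a \<in> homs K X X'" "a' \<in> homs K X' X" "a' \<cdot> a = idn K X"
    "a \<cdot> a' = idn K X'" using assms by (auto simp: isom_def)
  obtain b b' where b: "b \<in> homs K Y Y'" "b' \<in> homs K Y' Y" "b' \<cdot> b = idn K Y"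
    "b \<cdot> b' = idn K Y'" using assms by (auto simp: isom_def)
  obtain c c' where c: "c \<in> homs K Z Z'" "c' \<in> homs K Z' Z" "c' \<cdot> c = idn K Z"
    "c \<cdot> c' = idn K Z'" using assms by (auto simp: isom_def)
  have h: "b \<cdot> f \<in> homs K X Y'" "c \<cdot> g \<in> homs K Y Z'" "SA a \<cdot> h \<in> homs K Z (S X')"
    using a b c T S_homs cmp_homs by blast+
  have i: "iso_arr K a" "iso_arr K b" "iso_arr K c"
    using a b c iso_arr_homs[OF a(1)] iso_arr_homs[OF b(1)] iso_arr_homs[OF c(1)] by blast+
  show ?thesis
    using tri_isom[OF t cmp_homs[OF a(2) h(1)] cmp_homs[OF b(2) h(2)] cmp_homs[OF c(2) h(3)]
        a(1) b(1) c(1) i] cmp_cancel[OF h(1) a(1-3)] cmp_cancel[OF h(2) b(1-3)]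
      cmp_cancel[OF h(3) c(1-3)] extI by metis
qed

lemma ext_rot: "ext X Y Z \<Longrightarrow> ext Y Z (S X)"
  unfolding ext_def using tri_rot by blast

lemma ext_S: "ext X Y Z \<Longrightarrow> ext (S X) (S Y) (S Z)"
  using ext_rot by blast

lemma ext_Sn: "ext X Y Z \<Longrightarrow> ext (Sn n X) (Sn n Y) (Sn n Z)"
  by (induction n) (auto intro: ext_S)

lemma ext_back:
  assumes "ext Y Z (S X)" "X \<in> ob K"
  shows "ext X Y Z"
proof -
  obtain g h k where t: "tri Y Z (S X) g h k" using assms ext_def by blast
  note T = triD[OF t]
  obtain f where f: "f \<in> homs K X Y" "SA f = neg K k"
    using S_full[OF neg_homs[OF T(3)] assms(2) T(5)] .
  then have "k = neg K (SA f)" using neg_neg T(3) by simp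
  then show ?thesis using tri_rotate[OF f(1) T(1,2)] t extI by simp
qed

lemma ext_zero_left: "ext X Y Z \<Longrightarrow> is_zero K X \<Longrightarrow> isom Y Z"
proof -
  assume a: "ext X Y Z" "is_zero K X"
  obtain f g h where t: "tri X Y Z f g h" using a ext_def by blast
  note T = triD[OF t]
  \<comment> \<open>The split triangle of \<open>tri_idn'\<close> has the same zero third arrow, so
    \<open>fiber_unique\<close> compares the middle objects.\<close>
  have "h = nul K Z (S X)" using hom0_zero[OF T(7) S_zero[OF a(2)]] T(3) hom0_def by blast
  then show ?thesis using fiber_unique[OF _ tri_idn'[OF T(7) a(2)]] t by blast
qed

lemma ext_zero_right: "ext X Y Z \<Longrightarrow> is_zero K Z \<Longrightarrow> isom X Y"
proof -
  assume a: "ext X Y Z" "is_zero K Z"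
  obtain f g h where t: "tri X Y Z f g h" using a ext_def by blast
  note T = triD[OF t]
  have "h = nul K Z (S X)" using hom0_zero_left[OF S_ob[OF T(5)] a(2)] T(3) hom0_def by blast
  then show ?thesis using fiber_unique[OF tri_idn[OF T(5) a(2)]] t by blast
qed

text \<open>The connecting arrow runs between suspensions, so it desuspends to some
  \<open>k\<close>, and \<open>W\<close> is the middle object of a triangle with third arrow
  \<open>k\<close>. The sign in the choice of \<open>k\<close> cancels that of
  \<open>tri_S\<close>.\<close>

lemma ext_desuspend:
  assumes "ext (S X) Y (S Z)" "X \<in> ob K" "Z \<in> ob K"
  obtains W where "ext X W Z" "isom Y (S W)"
proof -
  obtain f g h where t: "tri (S X) Y (S Z) f g h" using assms ext_def by blast
  note T = triD[OF t]
  obtain k where k: "k \<in> homs K Z (S X)" "SA k = neg K h"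
    using S_full[OF neg_homs[OF T(3)] assms(3) S_ob[OF assms(2)]] .
  obtain W f' g' where W: "tri X W Z f' g' k" using tri_of_third[OF k(1) assms(2)] .
  have "neg K (SA k) = h" using k neg_neg T by simp
  then have "isom Y (S W)" using fiber_unique[OF t] tri_S[OF W] by simp
  then show ?thesis using that W extI by blast
qed

lemma hom0_ext:
  assumes "ext X Y Z" "hom0 L X" "hom0 L Z"
  shows "hom0 L Y"
proof -
  obtain f g h where t: "tri X Y Z f g h" using assms ext_def by blast
  note T = triD[OF t]
  have L: "L \<in> ob K" using assms hom0_def by blast
  have "u = nul K L Y" if u: "u \<in> homs K L Y" for u
  proof -
    have "g \<cdot> u = nul K L Z" using cmp_homs[OF u T(2)] assms(3) hom0_def by blast
    then obtain u' where u': "u' \<in> homs K L X" "f \<cdot> u' = u" using weak_kernel[OF t u] by blast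
    then have "u' = nul K L X" using assms(2) hom0_def by blast
    then show ?thesis using u' cmp_nul[OF L T(1)] by simp
  qed
  then show ?thesis using L T hom0_def by blast
qed

text \<open>The axiom does not say where \<open>u\<close> and \<open>v\<close> start and end, and composites of non-composable arrows
  are junk; the last two equations nevertheless force the right objects.\<close>

lemma octahedral_ext:
  assumes "tri X Y A f f1 f2" "tri Y Z B g g1 g2" "tri X Z D (g \<cdot> f) h1 h2"
  shows "ext A D B"
proof -
  note T1 = triD[OF assms(1)] and T2 = triD[OF assms(2)] and T3 = triD[OF assms(3)]
  obtain u v where uv: "(u, v, SA f1 \<cdot> g2) \<in> dist K" "h2 \<cdot> u = f2" "g2 \<cdot> v = SA f \<cdot> h2"
    using octahedral[OF T1(1) T2(1) T1(4) T2(4) T3(4)] by blast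
  have k: "SA f1 \<cdot> g2 \<in> homs K B (S A)" using cmp_homs[OF T2(3) S_homs[OF T1(2)]] .
  then have B: "dm K (SA f1 \<cdot> g2) = B" by (simp add: homs_def)
  have t: "tri (dm K u) (dm K v) B u v (SA f1 \<cdot> g2)" using dist_tri[OF uv(1)] B by simp
  note T = triD[OF t]
  have "SA f \<cdot> h2 \<in> homs K (dm K v) (S Y)" "SA f \<cdot> h2 \<in> homs K D (S Y)"
    using cmp_homs[OF T(2) T2(3)] cmp_homs[OF T3(3) S_homs[OF T1(1)]] uv by simp_all
  then have D: "dm K v = D" by (auto simp: homs_def)
  then have "u \<in> homs K (dm K u) D" using T by simp
  then have "f2 \<in> homs K (dm K u) (S X)" using cmp_homs T3(3) uv by blast
  then have "dm K u = A" using T1(3) by (auto simp: homs_def)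
  then show ?thesis using t D extI by simp
qed

text \<open>By rotation and invariance under \<open>S\<close>, closure under cones implies the other
  two closure conditions on triangles.\<close>

lemma thickI:
  assumes sub: "\<And>X. P X \<Longrightarrow> X \<in> ob K"
    and zero: "\<And>Z. is_zero K Z \<Longrightarrow> P Z"
    and susp: "\<And>X. X \<in> ob K \<Longrightarrow> P (S X) \<longleftrightarrow> P X"
    and cone: "\<And>X Y Z. ext X Y Z \<Longrightarrow> P X \<Longrightarrow> P Y \<Longrightarrow> P Z"
    and retr: "\<And>X Y. P X \<Longrightarrow> retr Y X \<Longrightarrow> P Y"
  shows "thick K {X. P X}"
proof -
  have "(P X \<and> P Y \<longrightarrow> P Z) \<and> (P Y \<and> P Z \<longrightarrow> P X) \<and> (P X \<and> P Z \<longrightarrow> P Y)"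
    if e: "ext X Y Z" for X Y Z
    using cone[OF e] cone[OF ext_rot[OF e]] cone[OF ext_rot[OF ext_rot[OF e]]]
      susp ext_ob[OF e] by blast
  then have "(P (dm K f) \<and> P (dm K g) \<longrightarrow> P (dm K h)) \<and> (P (dm K g) \<and> P (dm K h) \<longrightarrow> P (dm K f)) \<and>
      (P (dm K f) \<and> P (dm K h) \<longrightarrow> P (dm K g))" if "(f, g, h) \<in> dist K" for f g h
    using extI[OF dist_tri[OF that]] by blast
  moreover have "P Y" if "P X" "s \<in> homs K Y X" "r \<in> homs K X Y" "r \<cdot> s = idn K Y" for X Y r s
    using retr[OF that(1), of Y] that retr_def by blast
  ultimately show ?thesis
    unfolding thick_def using sub zero susp by (auto split: prod.splits)
qed

lemma thick_zero: "thick K {X. is_zero K X}"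
proof (rule thickI)
  show "is_zero K Z" if "ext X Y Z" "is_zero K X" "is_zero K Y" for X Y Z
    using ext_zero_left[OF that(1,2)] that isom_sym isom_retr is_zero_retr by blast
qed (auto intro: is_zero_ob is_zero_retr simp: S_zero_iff)

end


subsection \<open>Exact functors\<close>

context triangulated_category
begin

lemma exact_endofunctorD:
  assumes "exact_endofunctor K Fo Fa"
  shows "additive_endofunctor K Fo Fa" "endofunctor K Fo Fa"
  using assms by (auto simp: exact_endofunctor_def additive_endofunctor_def)

lemma exact_tri:
  assumes "exact_endofunctor K Fo Fa" "tri X Y Z f g h"
  obtains h' where "tri (Fo X) (Fo Y) (Fo Z) (Fa f) (Fa g) h'"
proof -
  note T = triD[OF assms(2)] and F = exact_endofunctorD[OF assms(1)]
  obtain e where e: "\<forall>X \<in> ob K. e X \<in> homs K (Fo (S X)) (S (Fo X)) \<and> iso_arr K (e X)"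
    "\<forall>(f, g, h) \<in> dist K. (Fa f, Fa g, e (dm K f) \<cdot> Fa h) \<in> dist K"
    using assms(1) unfolding exact_endofunctor_def by blast
  have "dm K f = X" using T by (simp add: homs_def)
  then have "(Fa f, Fa g, e X \<cdot> Fa h) \<in> dist K" using e(2) T(4) by fastforce
  moreover have "e X \<cdot> Fa h \<in> homs K (Fo Z) (S (Fo X))"
    using e(1) T(5) cmp_homs endofunctor_homs[OF F(2) T(3)] by blast
  ultimately show ?thesis
    using that endofunctor_homs[OF F(2) T(1)] endofunctor_homs[OF F(2) T(2)]
    by (simp add: tri_def)
qed

lemma exact_ext: "exact_endofunctor K Fo Fa \<Longrightarrow> ext X Y Z \<Longrightarrow> ext (Fo X) (Fo Y) (Fo Z)"
  unfolding ext_def by (metis exact_tri)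

lemma exact_S: "exact_endofunctor K Fo Fa \<Longrightarrow> X \<in> ob K \<Longrightarrow> isom (Fo (S X)) (S (Fo X))"
  unfolding exact_endofunctor_def using iso_arr_isom by blast

lemma exact_zero: "exact_endofunctor K Fo Fa \<Longrightarrow> is_zero K Z \<Longrightarrow> is_zero K (Fo Z)"
  using additive_endofunctor_zero[OF exact_endofunctorD(1)] .

lemma exact_retr: "exact_endofunctor K Fo Fa \<Longrightarrow> retr X Y \<Longrightarrow> retr (Fo X) (Fo Y)"
  using endofunctor_retr[OF category_axioms exact_endofunctorD(2)] .

lemma exact_isom: "exact_endofunctor K Fo Fa \<Longrightarrow> isom X Y \<Longrightarrow> isom (Fo X) (Fo Y)"
  using endofunctor_isom[OF category_axioms exact_endofunctorD(2)] .

lemma exact_ob: "exact_endofunctor K Fo Fa \<Longrightarrow> X \<in> ob K \<Longrightarrow> Fo X \<in> ob K"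
  using endofunctor_ob[OF exact_endofunctorD(2)] .

lemma exact_Sn: "exact_endofunctor K Fo Fa \<Longrightarrow> X \<in> ob K \<Longrightarrow> isom (Fo (Sn n X)) (Sn n (Fo X))"
proof (induction n)
  case 0
  then show ?case using isom_refl exact_ob by simp
next
  case (Suc n)
  have "isom (Fo (S (Sn n X))) (S (Fo (Sn n X)))" using Suc Sn_ob exact_S by blast
  then show ?case using Suc S_isom isom_trans by auto
qed

end


section \<open>Categories generated by an object without negative self-extensions\<close>

locale connective_triangulated = triangulated_category K
  for K :: "('o, 'm, 'z) tri_cat_scheme" (structure) +
  fixes U :: 'o
  assumes U_ob: "U \<in> ob K"
    and U_connective: "0 < n \<Longrightarrow> hom0 U (Sn n U)"
    and U_generates: "thick_hull K {U} = ob K"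
begin

text \<open>The homotopy groups of \<open>a\<close> vanish below degree \<open>n\<close>; as \<open>S\<close> need not be invertible on the nose,
  both arguments are suspended.\<close>

definition conn :: "nat \<Rightarrow> 'o \<Rightarrow> bool" where
  "conn n a \<longleftrightarrow> a \<in> ob K \<and> (\<forall>i j. i < n + j \<longrightarrow> hom0 (Sn i U) (Sn j a))"

lemma conn_ob: "conn n a \<Longrightarrow> a \<in> ob K"
  by (simp add: conn_def)

lemma connD: "conn n a \<Longrightarrow> i < n + j \<Longrightarrow> hom0 (Sn i U) (Sn j a)"
  by (simp add: conn_def)

lemma conn_U: "conn 0 U"
proof -
  have "hom0 (Sn i U) (Sn j U)" if "i < j" for i j
  proof -
    have "Sn j U = Sn i (Sn (j - i) U)" using that funpow_add[of i "j - i" S] by simp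
    then show ?thesis using hom0_Sn[OF U_ob Sn_ob[OF U_ob]] U_connective that by simp
  qed
  then show ?thesis using U_ob conn_def by simp
qed

lemma conn_mono: "conn n a \<Longrightarrow> m \<le> n \<Longrightarrow> conn m a"
  by (auto simp: conn_def)

lemma conn_S_iff:
  assumes "a \<in> ob K"
  shows "conn (Suc n) (S a) \<longleftrightarrow> conn n a"
proof
  assume c: "conn (Suc n) (S a)"
  have "hom0 (Sn i U) (Sn j a)" if "i < n + j" for i j
  proof -
    have "hom0 (Sn (Suc i) U) (Sn j (S a))" by (rule connD[OF c]) (use that in simp)
    then have "hom0 (S (Sn i U)) (S (Sn j a))" by (simp add: funpow_swap1)
    then show ?thesis using hom0_S Sn_ob U_ob assms by blast
  qed
  then show "conn n a" using assms conn_def by blast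
next
  assume c: "conn n a"
  have "hom0 (Sn i U) (Sn j (S a))" if "i < Suc n + j" for i j
  proof -
    have "hom0 (Sn i U) (Sn (Suc j) a)" by (rule connD[OF c]) (use that in simp)
    then show ?thesis by (simp add: funpow_swap1)
  qed
  then show "conn (Suc n) (S a)" using assms S_ob conn_def by blast
qed

lemma conn_S: "conn n a \<Longrightarrow> conn (Suc n) (S a)"
  using conn_S_iff conn_ob by blast

lemma conn_retr: "conn n a \<Longrightarrow> retr b a \<Longrightarrow> conn n b"
  unfolding conn_def using retr_ob Sn_retr hom0_retr by blast

lemma conn_isom: "conn n a \<Longrightarrow> isom a b \<Longrightarrow> conn n b"
  using conn_retr isom_retr isom_sym by blast

lemma conn_zero: "is_zero K a \<Longrightarrow> conn n a"
  unfolding conn_def using is_zero_ob hom0_zero Sn_zero_iff Sn_ob U_ob by simp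

lemma conn_ext:
  assumes "ext a b c" "conn n a" "conn n c"
  shows "conn n b"
proof -
  have "hom0 (Sn i U) (Sn j b)" if "i < n + j" for i j
    using hom0_ext[OF ext_Sn[OF assms(1)] connD[OF assms(2) that] connD[OF assms(3) that]] .
  then show ?thesis using ext_ob[OF assms(1)] conn_def by blast
qed

lemma conn_cone: "ext a b c \<Longrightarrow> conn n b \<Longrightarrow> conn n (S a) \<Longrightarrow> conn n c"
  using conn_ext[OF ext_rot] .

lemma conn_hom0: "conn (Suc n) a \<Longrightarrow> hom0 U a"
  using connD[of "Suc n" a 0 0] by simp

text \<open>Compared with \<open>conn 0\<close> only the indices i = j are new, and there both sides
  desuspend to \<open>hom0 U a\<close>.\<close>

lemma conn_1I:
  assumes "conn 0 a" "hom0 U a"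
  shows "conn 1 a"
proof -
  have "hom0 (Sn i U) (Sn j a)" if "i < 1 + j" for i j
  proof (cases "i = j")
    case True
    then show ?thesis using assms hom0_Sn U_ob conn_ob by simp
  next
    case False
    then show ?thesis using assms(1) that conn_def by simp
  qed
  then show ?thesis using assms conn_def by blast
qed


subsection \<open>Cellular objects\<close>

text \<open>The cells of a cellular object are suspensions of \<open>U\<close>, attached in order of increasing
  dimension.\<close>

inductive cell :: "'o \<Rightarrow> bool" where
  cell_zero: "is_zero K w \<Longrightarrow> cell w"
| cell_attach: "ext U w w' \<Longrightarrow> cell w' \<Longrightarrow> cell w"
| cell_susp: "cell v \<Longrightarrow> isom (S v) w \<Longrightarrow> cell w"

lemma cell_ob: "cell w \<Longrightarrow> w \<in> ob K"
  by (induction rule: cell.induct) (auto dest: is_zero_ob ext_ob isom_ob)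

lemma cell_isom:
  assumes "cell w" "isom w w'"
  shows "cell w'"
  using assms(1)
proof cases
  case cell_zero
  then show ?thesis using assms isom_sym isom_retr is_zero_retr cell.cell_zero by blast
next
  case (cell_attach x)
  then have "ext U w' x" using assms ext_isom ext_ob isom_refl by meson
  then show ?thesis using cell_attach cell.cell_attach by blast
next
  case (cell_susp v)
  then show ?thesis using assms isom_trans cell.cell_susp by blast
qed

lemma cell_S: "cell w \<Longrightarrow> cell (S w)"
  using cell_susp isom_refl S_ob cell_ob by blast

lemma cell_Sn: "cell w \<Longrightarrow> cell (Sn n w)"
  by (induction n) (auto intro: cell_S)

lemma cell_U: "cell U"
proof -
  obtain Z where "is_zero K Z" using zero_object by blast
  then show ?thesis using cell_attach cell_zero extI[OF tri_idn] U_ob by blast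
qed

lemma cell_conn: "cell w \<Longrightarrow> conn 0 w"
proof (induction rule: cell.induct)
  case (cell_susp v w)
  then have "conn 0 (S v)" using conn_mono[OF conn_S] by blast
  then show ?case using conn_isom cell_susp by blast
qed (auto intro: conn_zero conn_ext conn_U)

text \<open>This sorts the cells of an extension by dimension. A bottom cell of \<open>a\<close> is
  also attached first in \<open>b\<close>, and the octahedral axiom removes it from both. If
  \<open>a\<close> is a suspension, a bottom cell of \<open>c\<close> lifts to \<open>b\<close>,
  because the obstruction is an arrow from \<open>U\<close> to a double suspension of a connective
  object; the octahedral axiom then removes it from \<open>b\<close> and \<open>c\<close>. If both
  ends are suspensions, the whole extension desuspends.\<close>

lemma cell_ext: "cell a \<Longrightarrow> cell c \<Longrightarrow> ext a b c \<Longrightarrow> cell b"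
proof (induction a arbitrary: b c rule: cell.induct)
  case (cell_zero w)
  then show ?case using ext_zero_left isom_sym cell_isom by blast
next
  case (cell_attach w w')
  obtain x x1 x2 where x: "tri U w w' x x1 x2" using cell_attach ext_def by blast
  obtain g g1 g2 where g: "tri w b c g g1 g2" using cell_attach ext_def by blast
  obtain d h1 h2 where d: "tri U b d (g \<cdot> x) h1 h2"
    using tri_cone[OF cmp_homs[OF triD(1)[OF x] triD(1)[OF g]]] by blast
  have "ext w' d c" using octahedral_ext[OF x g d] .
  then show ?case using cell_attach cell.cell_attach extI[OF d] by blast
next
  case (cell_susp v w)
  have v: "v \<in> ob K" "conn 0 v" using cell_susp cell_ob cell_conn by blast+
  have "cell b" if "cell c" "ext (S v) b c" for b c
    using that
  proof (induction c arbitrary: b rule: cell.induct)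
    case (cell_zero c)
    then show ?case using ext_zero_right cell_isom cell_S cell_susp.hyps by blast
  next
    case (cell_attach c c')
    obtain y y1 y2 where y: "tri U c c' y y1 y2" using cell_attach ext_def by blast
    obtain f g h where t: "tri (S v) b c f g h" using cell_attach ext_def by blast
    note T = triD[OF t] and Y = triD[OF y]
    have "conn 2 (S (S v))" using conn_S[OF conn_S[OF v(2)]] by (simp add: numeral_2_eq_2)
    then have "hom0 U (S (S v))" using conn_hom0[of 1] by (simp add: numeral_2_eq_2)
    then have "h \<cdot> y = nul K U (S (S v))" using cmp_homs[OF Y(1) T(3)] hom0_def by blast
    then obtain l where l: "l \<in> homs K U b" "g \<cdot> l = y" using weak_kernel'[OF t Y(1)] by blast
    obtain d l1 l2 where d: "tri U b d l l1 l2" using tri_cone[OF l(1)] by blast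
    have "ext d c' (S (S v))" using octahedral_ext[OF d tri_rot[OF t]] y l by simp
    then have "ext (S v) d c'" using ext_back S_ob v by blast
    then show ?case using cell_attach cell.cell_attach extI[OF d] by blast
  next
    case (cell_susp v2 c)
    then have "ext (S v) b (S v2)" using ext_isom ext_ob isom_refl isom_sym by meson
    then obtain d where d: "ext v d v2" "isom b (S d)" using ext_desuspend v cell_susp cell_ob by blast
    then have "cell d" using \<open>\<And>b c. cell c \<Longrightarrow> ext v b c \<Longrightarrow> cell b\<close> cell_susp by blast
    then show ?case using d isom_sym cell.cell_susp by blast
  qed
  moreover have "ext (S v) b c" using cell_susp ext_isom ext_ob isom_refl isom_sym by meson
  ultimately show ?case using cell_susp by blast
qed

text \<open>The arrow \<open>f\<close> is replaced by \<open>s' \<cdot> f \<cdot> r\<close> between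
  the cellular objects: it commutes with both the sections and the retractions, so the cone of
  \<open>f\<close> is a retract of its cone \<open>x\<close>. The latter is an extension with ends
  \<open>w\<close> and \<open>S v\<close>, hence cellular.\<close>

lemma cell_retr_cone:
  assumes "ext a b c" "retr a v" "cell v" "retr b w" "cell w"
  shows "\<exists>x. cell x \<and> retr c x"
proof -
  obtain f g h where t: "tri a b c f g h" using assms ext_def by blast
  note T = triD[OF t]
  obtain s r where s: "s \<in> homs K a v" "r \<in> homs K v a" "r \<cdot> s = idn K a"
    using assms by (auto simp: retr_def)
  obtain s' r' where s': "s' \<in> homs K b w" "r' \<in> homs K w b" "r' \<cdot> s' = idn K b"
    using assms by (auto simp: retr_def)
  have sf: "s' \<cdot> f \<in> homs K a w" using cmp_homs[OF T(1) s'(1)] .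
  have sfr: "(s' \<cdot> f) \<cdot> r \<in> homs K v w" using cmp_homs[OF s(2) sf] .
  obtain x k l where x: "tri v w x ((s' \<cdot> f) \<cdot> r) k l" using tri_cone[OF sfr] by blast
  have 1: "s' \<cdot> f = ((s' \<cdot> f) \<cdot> r) \<cdot> s" using cmp_cancel[OF sf s] by simp
  have "r' \<cdot> ((s' \<cdot> f) \<cdot> r) = (r' \<cdot> (s' \<cdot> f)) \<cdot> r" using cmp_assoc[OF s(2) sf s'(2)] by simp
  also have "r' \<cdot> (s' \<cdot> f) = f"
    using cmp_assoc[OF T(1) s'(1,2)] s'(3) idn_cmp[OF T(1)] by simp
  finally have 2: "r' \<cdot> ((s' \<cdot> f) \<cdot> r) = f \<cdot> r" .
  have "retr c x" using cone_retr[OF t x s s' 1 2] iso_comp_retr by metis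
  moreover have "cell x" using cell_ext ext_rot[OF extI[OF x]] cell_S assms by blast
  ultimately show ?thesis by blast
qed

text \<open>The suspensions are there because cellular objects have no cells of negative
  dimension.\<close>

definition built :: "'o \<Rightarrow> bool" where
  "built a \<longleftrightarrow> a \<in> ob K \<and> (\<exists>k w. cell w \<and> retr (Sn k a) w)"

lemma built_cone:
  assumes e: "ext a b c" and "built a" "built b"
  shows "built c"
proof -
  obtain k v where v: "cell v" "retr (Sn k a) v" using assms built_def by blast
  obtain l w where w: "cell w" "retr (Sn l b) w" using assms built_def by blast
  \<comment> \<open>Both objects are brought to the common number l + k of suspensions, so that one
    triangle relates them.\<close>
  have "retr (Sn (l + k) a) (Sn l v)" using Sn_retr[OF v(2), of l] by (simp add: funpow_add)
  moreover have "retr (Sn (l + k) b) (Sn k w)"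
    using Sn_retr[OF w(2), of k] by (simp add: funpow_add add.commute[of l k])
  ultimately show ?thesis
    using cell_retr_cone[OF ext_Sn[OF e]] cell_Sn v w ext_ob[OF e] built_def by blast
qed

lemma all_built:
  assumes "a \<in> ob K"
  shows "built a"
proof -
  have "thick K {a. built a}"
  proof (rule thickI)
    show "X \<in> ob K" if "built X" for X using that built_def by blast
    show "built Z" if "is_zero K Z" for Z
    proof -
      have "cell Z" "retr (Sn 0 Z) Z" using that cell_zero retr_refl is_zero_ob by auto
      then show ?thesis using that is_zero_ob built_def by blast
    qed
    show "built (S X) \<longleftrightarrow> built X" if X: "X \<in> ob K" for X
    proof
      assume "built (S X)"
      then obtain k w where "cell w" "retr (Sn k (S X)) w" using built_def by blast
      then have "cell w \<and> retr (Sn (Suc k) X) w" by (simp add: funpow_swap1)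
      then show "built X" using X built_def by blast
    next
      assume "built X"
      then obtain k w where "cell w" "retr (Sn k X) w" using built_def by blast
      then have "cell (S w)" "retr (Sn k (S X)) (S w)"
        using cell_S S_retr[of "Sn k X" w] by (auto simp: funpow_swap1)
      then show "built (S X)" using X S_ob built_def by blast
    qed
    show "built Z" if "ext X Y Z" "built X" "built Y" for X Y Z
      using that built_cone by blast
    show "built Y" if "built X" "retr Y X" for X Y
      using that retr_ob Sn_retr retr_trans unfolding built_def by blast
  qed
  moreover have "built U"
    using U_ob cell_U retr_refl funpow_0 unfolding built_def by metis
  ultimately show ?thesis using assms U_generates unfolding thick_hull_def by blast
qed

text \<open>If the bottom group of \<open>a\<close> is zero, the retraction kills a bottom cell of
  \<open>w\<close> and so factors through the cone \<open>w'\<close>, of which \<open>a\<close> is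
  then a retract as well. If \<open>w\<close> is a suspension, the retract desuspends with it. As
  \<open>a\<close> is nonzero, the descent ends at a nonzero bottom group.\<close>

lemma cell_descend:
  "cell w \<Longrightarrow> retr a w \<Longrightarrow> \<not> is_zero K a \<Longrightarrow>
    \<exists>d a0 w0. isom a (Sn d a0) \<and> retr a0 w0 \<and> cell w0 \<and> \<not> hom0 U a0"
proof (induction w arbitrary: a rule: cell.induct)
  case (cell_zero w)
  then show ?case using is_zero_retr by blast
next
  case (cell_attach w w')
  have a: "a \<in> ob K" using cell_attach retr_ob by blast
  show ?case
  proof (cases "hom0 U a")
    case False
    have "isom a (Sn 0 a)" using a isom_refl by simp
    then show ?thesis using False cell_attach cell.cell_attach by blast
  next
    case True
    obtain x q h where t: "tri U w w' x q h" using cell_attach ext_def by blast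
    note T = triD[OF t]
    obtain s r where s: "s \<in> homs K a w" "r \<in> homs K w a" "r \<cdot> s = idn K a"
      using cell_attach by (auto simp: retr_def)
    have "r \<cdot> x = nul K U a" using True cmp_homs[OF T(1) s(2)] hom0_def by blast
    then obtain r' where r': "r' \<in> homs K w' a" "r' \<cdot> q = r" using weak_cokernel[OF t s(2)] by blast
    have "r' \<cdot> (q \<cdot> s) = idn K a" using cmp_assoc[OF s(1) T(2) r'(1)] r' s by simp
    then have "retr a w'" using cmp_homs[OF s(1) T(2)] r' retr_def by blast
    then show ?thesis using cell_attach by blast
  qed
next
  case (cell_susp v w)
  obtain a1 where a1: "a1 \<in> ob K" "isom a (S a1)" using cell_susp retr_ob desuspend by blast
  have "retr (S a1) (S v)"
    using retr_trans[OF retr_trans[OF isom_retr[OF isom_sym[OF a1(2)]] cell_susp.prems(1)]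
        isom_retr[OF isom_sym[OF cell_susp.hyps(2)]]] .
  then have "retr a1 v" using S_retr_cancel a1 cell_susp cell_ob by blast
  moreover have "\<not> is_zero K a1" using cell_susp a1 S_zero is_zero_retr isom_retr by blast
  ultimately obtain d a0 w0 where "isom a1 (Sn d a0)" "retr a0 w0" "cell w0" "\<not> hom0 U a0"
    using cell_susp by blast
  moreover from this have "isom a (Sn (Suc d) a0)" using a1 S_isom isom_trans by auto
  ultimately show ?case by blast
qed

lemma descend:
  assumes "a \<in> ob K" "\<not> is_zero K a"
  obtains k d a0 w where "isom (Sn k a) (Sn d a0)" "retr a0 w" "cell w" "\<not> hom0 U a0"
proof -
  obtain k w where "cell w" "retr (Sn k a) w" using all_built assms built_def by blast
  moreover have "\<not> is_zero K (Sn k a)" using assms Sn_zero_iff by blast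
  ultimately show ?thesis using cell_descend that by blast
qed

text \<open>The descent starts from \<open>Sn k a\<close> and removes \<open>d\<close> suspensions.
  If d < k, the nonzero bottom group of \<open>a0\<close> would be a homotopy group of
  \<open>a\<close> in the negative degree d - k; so d \<ge> k, and the \<open>k\<close> suspensions
  cancel.\<close>

lemma conn_retr_cell:
  assumes "conn 0 a"
  shows "\<exists>w. cell w \<and> retr a w"
proof (cases "is_zero K a")
  case True
  then show ?thesis using cell_zero retr_refl conn_ob assms by blast
next
  case False
  note a = conn_ob[OF assms]
  obtain k d a0 w where w: "isom (Sn k a) (Sn d a0)" "retr a0 w" "cell w" "\<not> hom0 U a0"
    using descend[OF a False] .
  have a0: "a0 \<in> ob K" using w retr_ob by blast
  have "\<not> d < k"
  proof
    assume "d < k"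
    then have "hom0 (Sn d U) (Sn k a)" using assms conn_def by simp
    then have "hom0 (Sn d U) (Sn d a0)" using hom0_retr isom_retr isom_sym w by blast
    then show False using w hom0_Sn U_ob a0 by blast
  qed
  then have "Sn d a0 = Sn k (Sn (d - k) a0)" using funpow_add[of k "d - k" S] by simp
  then have "isom a (Sn (d - k) a0)" using w Sn_isom_cancel a Sn_ob[OF a0] by metis
  then have "retr a (Sn (d - k) w)" using isom_retr retr_trans Sn_retr w by blast
  then show ?thesis using w cell_Sn by blast
qed

text \<open>For \<open>a\<close> with \<open>conn 0 a\<close> this says that the zeroth homotopy group of \<open>a\<close> is finitely generated.\<close>

inductive gen :: "'o \<Rightarrow> bool" where
  gen_conn: "conn 1 a \<Longrightarrow> gen a"
| gen_attach: "ext U a a' \<Longrightarrow> gen a' \<Longrightarrow> gen a"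

text \<open>The image of a bottom cell of \<open>w\<close> is coned off in \<open>a\<close>, and the
  fill-in between the cones is again surjective on bottom groups: as Hom(U, S U) = 0, every class of
  \<open>a'\<close> lifts to \<open>a\<close>. Once the source has no bottom group, surjectivity
  leaves none in \<open>a\<close>.\<close>

lemma gen_of_surj:
  "cell w \<Longrightarrow> r \<in> homs K w a \<Longrightarrow> (\<And>u. u \<in> homs K U a \<Longrightarrow> \<exists>v \<in> homs K U w. u = r \<cdot> v) \<Longrightarrow>
    conn 0 a \<Longrightarrow> gen a"
proof (induction w arbitrary: r a rule: cell.induct)
  case (cell_attach w w')
  obtain x q h where t: "tri U w w' x q h" using cell_attach ext_def by blast
  note T = triD[OF t]
  have rx: "r \<cdot> x \<in> homs K U a" using cmp_homs[OF T(1)] cell_attach by blast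
  obtain a' q' h' where t': "tri U a a' (r \<cdot> x) q' h'" using tri_cone[OF rx] by blast
  note T' = triD[OF t']
  have "r \<cdot> x = (r \<cdot> x) \<cdot> idn K U" using cmp_idn[OF rx] by simp
  from tri_fill[OF t t' idn_homs[OF U_ob] cell_attach.prems(1) this]
  obtain c where c: "c \<in> homs K w' a'" "c \<cdot> q = q' \<cdot> r" by blast
  have "\<exists>v \<in> homs K U w'. u = c \<cdot> v" if u: "u \<in> homs K U a'" for u
  proof -
    have "hom0 U (S U)" using conn_hom0[OF conn_S[OF conn_U]] .
    then have "h' \<cdot> u = nul K U (S U)" using cmp_homs[OF u T'(3)] hom0_def by blast
    then obtain u1 where u1: "u1 \<in> homs K U a" "q' \<cdot> u1 = u" using weak_kernel'[OF t' u] by blast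
    obtain v where v: "v \<in> homs K U w" "u1 = r \<cdot> v" using cell_attach.prems(2) u1 by blast
    have "u = c \<cdot> (q \<cdot> v)"
      using u1 v c cmp_assoc[OF v(1) cell_attach.prems(1) T'(2)] cmp_assoc[OF v(1) T(2) c(1)]
      by simp
    then show ?thesis using cmp_homs[OF v(1) T(2)] by blast
  qed
  moreover have "conn 0 a'"
    using conn_cone[OF extI[OF t'] cell_attach.prems(3)] conn_S[OF conn_U] conn_mono by blast
  ultimately have "gen a'" using cell_attach.IH c by blast
  then show ?case using gen_attach extI[OF t'] by blast
next
  case (cell_zero w)
  have "hom0 U w" using hom0_zero U_ob cell_zero by blast
  then have "u = nul K U a" if "u \<in> homs K U a" for u
    using cell_zero that cmp_nul[OF U_ob] unfolding hom0_def by metis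
  then have "hom0 U a" using U_ob conn_ob cell_zero hom0_def by blast
  then show ?case using conn_1I gen_conn cell_zero by blast
next
  case (cell_susp v w)
  have "conn 1 w" using conn_isom conn_S cell_conn cell_susp by (metis One_nat_def)
  then have "hom0 U w" using conn_hom0 by simp
  then have "u = nul K U a" if "u \<in> homs K U a" for u
    using cell_susp that cmp_nul[OF U_ob] unfolding hom0_def by metis
  then have "hom0 U a" using U_ob conn_ob cell_susp hom0_def by blast
  then show ?case using conn_1I gen_conn cell_susp by blast
qed

lemma gen_retr:
  assumes "cell w" "retr a w"
  shows "gen a"
proof -
  obtain s r where s: "s \<in> homs K a w" "r \<in> homs K w a" "r \<cdot> s = idn K a"
    using assms by (auto simp: retr_def)
  have "\<exists>v \<in> homs K U w. u = r \<cdot> v" if u: "u \<in> homs K U a" for u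
  proof
    show "s \<cdot> u \<in> homs K U w" using cmp_homs[OF u s(1)] .
    show "u = r \<cdot> (s \<cdot> u)" using cmp_assoc[OF u s(1,2)] s idn_cmp[OF u] by simp
  qed
  then show ?thesis using gen_of_surj[OF assms(1) s(2)] conn_retr[OF cell_conn] assms by blast
qed

end


section \<open>The unit of a connective unigenic category\<close>

lemma (in cring) nonunit_in_maximalideal:
  assumes x: "x \<in> carrier R" "x \<notin> Units R"
  shows "\<exists>M. maximalideal M R \<and> x \<in> M"
proof -
  define A where "A = {I. ideal I R \<and> x \<in> I \<and> \<one> \<notin> I}"
  have "PIdl x \<in> A"
  proof -
    have "\<one> \<notin> PIdl x"
    proof
      assume "\<one> \<in> PIdl x"
      then obtain r where r: "r \<in> carrier R" "\<one> = r \<otimes> x" unfolding cgenideal_def by blast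
      then have "x \<in> Units R" using x m_comm unfolding Units_def by force
      then show False using x by blast
    qed
    then show ?thesis using x cgenideal_ideal cgenideal_self A_def by blast
  qed
  moreover have "\<Union>C \<in> A" if C: "C \<noteq> {}" "subset.chain A C" for C
  proof -
    have CA: "C \<subseteq> A" using C unfolding subset.chain_def by blast
    then have "subset.chain {I. ideal I R} C"
      using C unfolding subset.chain_def A_def by auto
    then have "ideal (\<Union>C) R" using chain_Union_is_ideal[of C] C by simp
    then show ?thesis using CA C unfolding A_def by auto
  qed
  ultimately obtain M where M: "M \<in> A" "\<And>I. I \<in> A \<Longrightarrow> M \<subseteq> I \<Longrightarrow> I = M"
    using subset_Zorn_nonempty[of A] by blast
  have "maximalideal M R"
  proof (rule maximalidealI)
    show "ideal M R" "carrier R \<noteq> M" using M A_def by auto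
    show "J = M \<or> J = carrier R" if J: "ideal J R" "M \<subseteq> J" "J \<subseteq> carrier R" for J
    proof (cases "\<one> \<in> J")
      case True
      then show ?thesis using ideal.one_imp_carrier J by blast
    next
      case False
      then have "J \<in> A" using J M A_def by blast
      then show ?thesis using M J by blast
    qed
  qed
  then show ?thesis using M A_def by blast
qed

text \<open>Two nonunits lie in the same maximal ideal, which would then contain their sum
  1.\<close>

lemma local_ring_units:
  fixes R (structure)
  assumes "local_ring R" "x \<in> carrier R"
  shows "x \<in> Units R \<or> \<one> \<ominus> x \<in> Units R"
proof (rule ccontr)
  interpret cring R using assms local_ring_def by blast
  assume n: "\<not> (x \<in> Units R \<or> \<one> \<ominus> x \<in> Units R)"
  then obtain M N where MN: "maximalideal M R" "x \<in> M" "maximalideal N R" "\<one> \<ominus> x \<in> N"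
    using nonunit_in_maximalideal assms by (metis minus_closed one_closed)
  then have "M = N" using assms(1) unfolding local_ring_def by blast
  interpret M: maximalideal M R using MN by blast
  have "x \<oplus> (\<one> \<ominus> x) \<in> M" using MN \<open>M = N\<close> M.a_closed by blast
  also have "x \<oplus> (\<one> \<ominus> x) = \<one>" using assms(2) by algebra
  finally show False using M.one_imp_carrier M.I_notcarr by blast
qed

locale connective_tt = tt_category K + connective_triangulated K "unit_ob K"
  for K :: "('o, 'm, 'z) tt_cat_scheme" (structure)
begin

abbreviation U :: 'o where "U \<equiv> unit_ob K"

section \<open>Tensoring with the unit and with connective objects\<close>

lemma runit_isom: "X \<in> ob K \<Longrightarrow> isom (X \<boxtimes> U) X"
  using runit_homs iso_arr_isom by blast

lemma lunit_isom: "X \<in> ob K \<Longrightarrow> isom (U \<boxtimes> X) X"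
  using lunit_homs iso_arr_isom by blast

lemma braid_isom: "X \<in> ob K \<Longrightarrow> Y \<in> ob K \<Longrightarrow> isom (X \<boxtimes> Y) (Y \<boxtimes> X)"
  unfolding isom_def using braid_homs braid_braid by blast

lemma iso_cancel_nul:
  assumes "f \<in> homs K X Y" "iso_arr K f" "g \<in> homs K Y Z" "g \<cdot> f = nul K X Z"
  shows "g = nul K Y Z"
proof -
  obtain f' where f': "f' \<in> homs K Y X" "f \<cdot> f' = idn K Y" using assms iso_arr_homs by blast
  have "g = (g \<cdot> f) \<cdot> f'" using cmp_assoc[OF f'(1) assms(1,3)] f' cmp_idn assms by simp
  also have "\<dots> = nul K Y Z" using assms nul_cmp[OF _ f'(1)] homs_ob by simp
  finally show ?thesis .
qed

text \<open>Naturality of the unit constraint identifies \<open>f \<boxdot> idn K U\<close> with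
  \<open>f\<close>. The final chase takes place after tensoring with \<open>U\<close>, and this
  brings its conclusion back.\<close>

lemma tens_unit_faithful:
  assumes f: "f \<in> homs K X Y" and z: "f \<boxdot> idn K U = nul K (X \<boxtimes> U) (Y \<boxtimes> U)"
  shows "f = nul K X Y"
proof -
  have XY: "X \<in> ob K" "Y \<in> ob K" using f homs_ob by auto
  then have "f \<cdot> runit K X = nul K (X \<boxtimes> U) Y"
    using runit_natural[OF f] z cmp_nul tens_ob unit_ob runit_homs by metis
  then show ?thesis using iso_cancel_nul runit_homs XY f by blast
qed

lemma unit_tens_faithful:
  assumes f: "f \<in> homs K X Y" and z: "idn K U \<boxdot> f = nul K (U \<boxtimes> X) (U \<boxtimes> Y)"
  shows "f = nul K X Y"
proof -
  have XY: "X \<in> ob K" "Y \<in> ob K" using f homs_ob by auto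
  then have "f \<cdot> lunit K X = nul K (U \<boxtimes> X) Y"
    using lunit_natural[OF f] z cmp_nul tens_ob unit_ob lunit_homs by metis
  then show ?thesis using iso_cancel_nul lunit_homs XY f by blast
qed

text \<open>Tensoring with \<open>b\<close> turns the cells of \<open>w\<close> into suspensions of
  \<open>b\<close>.\<close>

lemma cell_tens_conn:
  assumes b: "conn n b"
  shows "cell w \<Longrightarrow> conn n (w \<boxtimes> b)"
proof (induction rule: cell.induct)
  note E = tens_exact_left[OF conn_ob[OF b]]
  {
    case (cell_zero w)
    then show ?case using exact_zero[OF E] conn_zero by blast
  next
    case (cell_attach w w')
    then show ?case
      using exact_ext[OF E] conn_ext conn_isom[OF b] isom_sym[OF lunit_isom] conn_ob[OF b] by blast
  next
    case (cell_susp v w)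
    have "isom (S v \<boxtimes> b) (S (v \<boxtimes> b))" using exact_S[OF E] cell_ob cell_susp by blast
    moreover have "conn n (S (v \<boxtimes> b))" using conn_mono[OF conn_S] cell_susp by simp
    ultimately have "conn n (S v \<boxtimes> b)" using conn_isom isom_sym by blast
    then show ?case using conn_isom exact_isom[OF E] cell_susp by blast
  }
qed

lemma conn_tens:
  assumes "conn 0 a" "conn n b"
  shows "conn n (a \<boxtimes> b)"
  using conn_retr_cell[OF assms(1)] cell_tens_conn[OF assms(2)] conn_retr
    exact_retr[OF tens_exact_left[OF conn_ob[OF assms(2)]]] by blast

text \<open>Generators are coned off while the cone keeps a nonzero bottom group; when the next cone
  would lose it, one generator is left, as \<open>ext U a' a''\<close> with
  \<open>conn 1 a''\<close> expresses. The cone tensored with \<open>b\<close> is a cone of U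
  \<otimes> b -> a \<otimes> b, so it stays \<open>conn 1\<close>.\<close>

lemma gen_chain:
  assumes b: "conn 0 b"
  shows "gen a \<Longrightarrow> conn 0 a \<Longrightarrow> \<not> hom0 U a \<Longrightarrow> conn 1 (a \<boxtimes> b) \<Longrightarrow>
    \<exists>a' a''. ext U a' a'' \<and> conn 1 a'' \<and> conn 0 a' \<and> \<not> hom0 U a' \<and> conn 1 (a' \<boxtimes> b)"
proof (induction rule: gen.induct)
  case (gen_conn a)
  then show ?case using conn_hom0 by simp
next
  case (gen_attach a a')
  have S: "conn 1 (S c)" if "conn 0 c" for c using conn_S[OF that] by simp
  have a': "conn 0 a'"
    using conn_cone[OF gen_attach.hyps(1) gen_attach.prems(1)] conn_mono[OF S[OF conn_U]] by blast
  have "conn 0 (U \<boxtimes> b)" using conn_isom[OF b] isom_sym[OF lunit_isom] conn_ob[OF b] by blast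
  then have "conn 1 (a' \<boxtimes> b)"
    using conn_cone exact_ext[OF tens_exact_left[OF conn_ob[OF b]] gen_attach.hyps(1)]
      gen_attach.prems(3) S by blast
  then show ?case
    using gen_attach a' conn_1I by (cases "hom0 U a'") blast+
qed

section \<open>Tensor products of nonzero objects\<close>

lemma is_zero_tens_shift:
  assumes "is_zero K (a \<boxtimes> b)" "isom (Sn k a) (Sn d a')" "a \<in> ob K" "a' \<in> ob K" "b \<in> ob K"
  shows "is_zero K (a' \<boxtimes> b)"
proof -
  note E = tens_exact_left[OF assms(5)]
  have "isom (Sn d (a' \<boxtimes> b)) (Sn d a' \<boxtimes> b)" using exact_Sn[OF E assms(4)] isom_sym by blast
  moreover have "isom (Sn d a' \<boxtimes> b) (Sn k a \<boxtimes> b)" using exact_isom[OF E] assms isom_sym by blast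
  ultimately have "retr (Sn d (a' \<boxtimes> b)) (Sn k (a \<boxtimes> b))"
    using exact_Sn[OF E assms(3)] isom_trans isom_retr by blast
  moreover have "is_zero K (Sn k (a \<boxtimes> b))" using assms Sn_zero_iff tens_ob by blast
  ultimately show ?thesis using is_zero_retr Sn_zero_iff tens_ob assms by blast
qed

text \<open>Since \<open>a''\<close> has no bottom group, every arrow from \<open>U\<close> to
  \<open>a\<close> factors through \<open>x\<close>.\<close>

lemma tri_unit_nonzero:
  assumes "tri U a a'' x q h" "conn 1 a''" "\<not> hom0 U a"
  shows "x \<noteq> nul K U a"
proof
  assume x: "x = nul K U a"
  note T = triD[OF assms(1)]
  have "u = nul K U a" if u: "u \<in> homs K U a" for u
  proof -
    have "hom0 U a''" using conn_hom0 assms(2) by simp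
    then have "q \<cdot> u = nul K U a''" using cmp_homs[OF u T(2)] hom0_def by blast
    then obtain u' where "u' \<in> homs K U U" "x \<cdot> u' = u" using weak_kernel[OF assms(1) u] by blast
    then show ?thesis using x nul_cmp T by blast
  qed
  then show False using assms(3) T hom0_def by blast
qed

text \<open>Here \<open>d\<close> is the fibre of \<open>x\<close>. Since \<open>x \<otimes> y\<close> vanishes, \<open>1 \<otimes> y\<close> factors through \<open>d \<otimes> 1\<close>, and by
  connectivity even as \<open>(1 \<otimes> y) \<circ> i\<close> with \<open>i\<close> factoring through \<open>d \<otimes> 1\<close>. If \<open>i\<close> is invertible then
  \<open>x = 0\<close>, and if \<open>1 - i\<close> is invertible then \<open>y = 0\<close>.\<close>

lemma tens_not_conn:
  assumes local: "\<And>j. j \<in> homs K U U \<Longrightarrow>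
      \<exists>k \<in> homs K U U. j \<dotplus> k = idn K U \<and> (iso_arr K j \<or> iso_arr K k)"
    and x: "tri U a a'' x q h" "conn 1 a''" "\<not> hom0 U a"
    and y: "tri U b b'' y q' h'" "conn 1 b''" "\<not> hom0 U b"
    and ab: "conn 1 (a \<boxtimes> b)"
  shows False
proof -
  note X = triD[OF x(1)] and Y = triD[OF y(1)]
  obtain z d g where d: "tri z U a d x g" "isom a'' (S z)" using tri_fiber[OF x(1)] .
  note D = triD[OF d(1)]
  \<comment> \<open>\<open>S z\<close> is isomorphic to the cone \<open>a''\<close>, so the fibre
    \<open>z\<close> is connective because \<open>x\<close> generates the bottom group of
    \<open>a\<close>.\<close>
  have "conn 1 (S z)" using conn_isom x d by blast
  then have z: "conn 0 z" using conn_S_iff D by simp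
  have I: "idn K U \<in> homs K U U" "idn K b \<in> homs K b b" "idn K z \<in> homs K z z"
    using idn_homs U_ob Y D by blast+
  have UU: "retr (U \<boxtimes> U) U" using runit_isom U_ob isom_retr by blast
  define y1 where "y1 = idn K U \<boxdot> y"
  have y1: "y1 \<in> homs K (U \<boxtimes> U) (U \<boxtimes> b)" unfolding y1_def using tens_homs[OF I(1) Y(1)] .
  obtain k1 where t1: "tri (z \<boxtimes> b) (U \<boxtimes> b) (a \<boxtimes> b) (d \<boxdot> idn K b) (x \<boxdot> idn K b) k1"
    using exact_tri[OF tens_exact_left[OF Y(6)] d(1)] .
  obtain k2 where t2: "tri (z \<boxtimes> U) (z \<boxtimes> b) (z \<boxtimes> b'') (idn K z \<boxdot> y) (idn K z \<boxdot> q') k2"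
    using exact_tri[OF tens_exact_right[OF D(5)] y(1)] .
  obtain k3 where t3: "tri (z \<boxtimes> U) (U \<boxtimes> U) (a \<boxtimes> U) (d \<boxdot> idn K U) (x \<boxdot> idn K U) k3"
    using exact_tri[OF tens_exact_left[OF U_ob] d(1)] .
  note T1 = triD[OF t1] and T2 = triD[OF t2] and T3 = triD[OF t3]
  \<comment> \<open>The composite below is x \<otimes> y, which lies in a zero group, so
    \<open>y1\<close> lifts along d \<otimes> 1.\<close>
  have "hom0 U (a \<boxtimes> b)" using conn_hom0 ab by simp
  then have "hom0 (U \<boxtimes> U) (a \<boxtimes> b)" using hom0_retr_left UU by blast
  then have "(x \<boxdot> idn K b) \<cdot> y1 = nul K (U \<boxtimes> U) (a \<boxtimes> b)"
    using cmp_homs[OF y1 T1(2)] hom0_def by blast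
  then obtain t where t: "t \<in> homs K (U \<boxtimes> U) (z \<boxtimes> b)" "(d \<boxdot> idn K b) \<cdot> t = y1"
    using weak_kernel[OF t1 y1] by blast
  \<comment> \<open>The obstruction to lifting \<open>t\<close> further along 1 \<otimes> y lives
    here; it vanishes since \<open>z\<close> is connective and \<open>b''\<close> is
    \<open>conn 1\<close>.\<close>
  have "hom0 U (z \<boxtimes> b'')" using conn_hom0 conn_tens[OF z y(2)] by simp
  then have "hom0 (U \<boxtimes> U) (z \<boxtimes> b'')" using hom0_retr_left UU by blast
  then have "(idn K z \<boxdot> q') \<cdot> t = nul K (U \<boxtimes> U) (z \<boxtimes> b'')"
    using cmp_homs[OF t(1) T2(2)] hom0_def by blast
  then obtain t' where t': "t' \<in> homs K (U \<boxtimes> U) (z \<boxtimes> U)" "(idn K z \<boxdot> y) \<cdot> t' = t"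
    using weak_kernel[OF t2 t(1)] by blast
  define i where "i = (d \<boxdot> idn K U) \<cdot> t'"
  have i: "i \<in> homs K (U \<boxtimes> U) (U \<boxtimes> U)" unfolding i_def using cmp_homs[OF t'(1) T3(1)] .
  \<comment> \<open>The arrows \<open>d\<close> and \<open>y\<close> act on different factors and
    can be interchanged; this turns the double lift into \<open>y1 \<cdot> i = y1\<close>.\<close>
  have "(d \<boxdot> idn K b) \<cdot> (idn K z \<boxdot> y) = (d \<cdot> idn K z) \<boxdot> (idn K b \<cdot> y)"
    using tens_cmp[OF I(3) D(1) Y(1) I(2)] by simp
  also have "\<dots> = (idn K U \<cdot> d) \<boxdot> (y \<cdot> idn K U)"
    using cmp_idn[OF D(1)] idn_cmp[OF D(1)] cmp_idn[OF Y(1)] idn_cmp[OF Y(1)] by simp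
  also have "\<dots> = y1 \<cdot> (d \<boxdot> idn K U)"
    using tens_cmp[OF D(1) I(1) I(1) Y(1)] y1_def by simp
  finally have dy: "(d \<boxdot> idn K b) \<cdot> (idn K z \<boxdot> y) = y1 \<cdot> (d \<boxdot> idn K U)" .
  have "y1 = ((d \<boxdot> idn K b) \<cdot> (idn K z \<boxdot> y)) \<cdot> t'"
    using t t' cmp_assoc[OF t'(1) T2(1) T1(1)] by simp
  also have "\<dots> = y1 \<cdot> i" using dy cmp_assoc[OF t'(1) T3(1) y1] i_def by simp
  finally have yi: "y1 \<cdot> i = y1" by simp
  have "(x \<boxdot> idn K U) \<cdot> i = nul K (z \<boxtimes> U) (a \<boxtimes> U) \<cdot> t'"
    using cmp_assoc[OF t'(1) T3(1,2)] tri_comp_nul[OF t3] i_def by simp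
  then have xi: "(x \<boxdot> idn K U) \<cdot> i = nul K (U \<boxtimes> U) (a \<boxtimes> U)" using nul_cmp[OF T3(7) t'(1)] by simp
  \<comment> \<open>The hypothesis on the ring concerns endomorphisms of \<open>U\<close>, so
    \<open>i\<close> is conjugated from \<open>U \<boxtimes> U\<close> to an endomorphism
    \<open>j\<close> of \<open>U\<close>.\<close>
  obtain c c' where c: "c \<in> homs K (U \<boxtimes> U) U" "c' \<in> homs K U (U \<boxtimes> U)" "c' \<cdot> c = idn K (U \<boxtimes> U)"
    "c \<cdot> c' = idn K U"
    using runit_isom[OF U_ob] unfolding isom_def by blast
  have ic': "iso_arr K c'" using iso_arr_homs[OF c(2)] c by blast
  define j where "j = c \<cdot> (i \<cdot> c')"
  have ij: "i \<cdot> c' \<in> homs K U (U \<boxtimes> U)" "j \<in> homs K U U"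
    unfolding j_def using c i cmp_homs by blast+
  have c'j: "c' \<cdot> j = i \<cdot> c'"
    unfolding j_def using cmp_assoc[OF ij(1) c(1,2)] c(3) idn_cmp[OF ij(1)] by simp
  have move: "(w \<cdot> c') \<cdot> j = (w \<cdot> i) \<cdot> c'" if "w \<in> homs K (U \<boxtimes> U) V" for w V
    using cmp_assoc[OF ij(2) c(2) that] c'j cmp_assoc[OF c(2) i that] by simp
  obtain k where k: "k \<in> homs K U U" "j \<dotplus> k = idn K U" "iso_arr K j \<or> iso_arr K k"
    using local[OF ij(2)] by blast
  from k(3) show False
  proof
    assume j: "iso_arr K j"
    have w: "(x \<boxdot> idn K U) \<cdot> c' \<in> homs K U (a \<boxtimes> U)" using cmp_homs[OF c(2) T3(2)] .
    have "((x \<boxdot> idn K U) \<cdot> c') \<cdot> j = nul K U (a \<boxtimes> U)"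
      using move[OF T3(2)] xi nul_cmp[OF T3(7) c(2)] by simp
    then have "(x \<boxdot> idn K U) \<cdot> c' = nul K U (a \<boxtimes> U)" using iso_cancel_nul[OF ij(2) j w] by simp
    then have "x \<boxdot> idn K U = nul K (U \<boxtimes> U) (a \<boxtimes> U)" using iso_cancel_nul[OF c(2) ic' T3(2)] by simp
    then show False using tens_unit_faithful[OF X(1)] tri_unit_nonzero[OF x] by blast
  next
    assume ki: "iso_arr K k"
    have w: "y1 \<cdot> c' \<in> homs K U (U \<boxtimes> b)" using cmp_homs[OF c(2) y1] .
    have wk: "(y1 \<cdot> c') \<cdot> k \<in> homs K U (U \<boxtimes> b)" using cmp_homs[OF k(1) w] .
    \<comment> \<open>As \<open>y1 \<cdot> c'\<close> is fixed by \<open>j\<close> and j + k = 1, it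
      is killed by \<open>k\<close>.\<close>
    have "y1 \<cdot> c' = (y1 \<cdot> c') \<cdot> (j \<dotplus> k)" using k cmp_idn[OF w] by simp
    also have "\<dots> = y1 \<cdot> c' \<dotplus> (y1 \<cdot> c') \<cdot> k"
      using cmp_plus_right[OF ij(2) k(1) w] move[OF y1] yi by simp
    finally have e: "y1 \<cdot> c' \<dotplus> (y1 \<cdot> c') \<cdot> k = y1 \<cdot> c'" by simp
    have "(y1 \<cdot> c') \<cdot> k = (neg K (y1 \<cdot> c') \<dotplus> y1 \<cdot> c') \<dotplus> (y1 \<cdot> c') \<cdot> k"
      using neg_plus[OF w] nul_plus[OF wk] by simp
    also have "\<dots> = nul K U (U \<boxtimes> b)"
      using plus_assoc[OF neg_homs[OF w] w wk] e neg_plus[OF w] by simp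
    finally have "y1 \<cdot> c' = nul K U (U \<boxtimes> b)" using iso_cancel_nul[OF k(1) ki w] by simp
    then have "y1 = nul K (U \<boxtimes> U) (U \<boxtimes> b)" using iso_cancel_nul[OF c(2) ic' y1] by simp
    then show False using unit_tens_faithful[OF Y(1)] tri_unit_nonzero[OF y] by (simp add: y1_def)
  qed
qed

lemma tens_zero_imp:
  assumes local: "\<And>j. j \<in> homs K U U \<Longrightarrow>
      \<exists>k \<in> homs K U U. j \<dotplus> k = idn K U \<and> (iso_arr K j \<or> iso_arr K k)"
    and ab: "a \<in> ob K" "b \<in> ob K" "is_zero K (a \<boxtimes> b)"
  shows "is_zero K a \<or> is_zero K b"
proof (rule ccontr)
  assume n: "\<not> (is_zero K a \<or> is_zero K b)"
  obtain k d a0 v where a: "isom (Sn k a) (Sn d a0)" "retr a0 v" "cell v" "\<not> hom0 U a0"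
    using descend ab n by blast
  obtain l e b0 w where b: "isom (Sn l b) (Sn e b0)" "retr b0 w" "cell w" "\<not> hom0 U b0"
    using descend ab n by blast
  have a0: "a0 \<in> ob K" "conn 0 a0" "gen a0"
    using a retr_ob conn_retr cell_conn gen_retr by blast+
  have b0: "b0 \<in> ob K" "conn 0 b0" "gen b0"
    using b retr_ob conn_retr cell_conn gen_retr by blast+
  \<comment> \<open>Shifting and coning off act on the left factor only, so the braiding exchanges
    the factors between the two rounds.\<close>
  have swap: "conn m (s \<boxtimes> r)" if "conn m (r \<boxtimes> s)" "r \<in> ob K" "s \<in> ob K" for m r s
    using conn_isom[OF that(1)] braid_isom that by blast
  have "is_zero K (a0 \<boxtimes> b)" using is_zero_tens_shift[OF ab(3) a(1)] ab a0 by blast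
  then have "is_zero K (b \<boxtimes> a0)" using braid_isom[OF ab(2) a0(1)] isom_retr is_zero_retr by blast
  then have "is_zero K (b0 \<boxtimes> a0)" using is_zero_tens_shift[OF _ b(1)] ab a0 b0 by blast
  then have "conn 1 (a0 \<boxtimes> b0)" using conn_zero swap a0 b0 by blast
  then obtain a1 a2 where a1: "ext U a1 a2" "conn 1 a2" "conn 0 a1" "\<not> hom0 U a1"
    "conn 1 (a1 \<boxtimes> b0)"
    using gen_chain[OF b0(2) a0(3,2) a(4)] by blast
  then have "conn 1 (b0 \<boxtimes> a1)" using swap conn_ob b0 by blast
  then obtain b1 b2 where b1: "ext U b1 b2" "conn 1 b2" "conn 0 b1" "\<not> hom0 U b1"
    "conn 1 (b1 \<boxtimes> a1)"
    using gen_chain[OF a1(3) b0(3,2) b(4)] by blast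
  obtain x q h where x: "tri U a1 a2 x q h" using a1 ext_def by blast
  obtain y q' h' where y: "tri U b1 b2 y q' h'" using b1 ext_def by blast
  show False using tens_not_conn[OF local y b1(2,4) x a1(2,4) b1(5)] .
qed

end

section \<open>The spectrum\<close>

text \<open>The basic open sets consist of the primes containing a given object. A prime other than
  the zero ideal contains a nonzero object, so the zero ideal is a closed point. It lies in every
  prime, so an open set containing it is the whole spectrum; hence every nonempty closed set
  contains it, and no other point is closed.\<close>

lemma (in tt_category) local_if_zero_prime:
  assumes "prime_ideal K {X. is_zero K X}"
  shows "local_tt_category K"
proof -
  let ?O = "{X. is_zero K X}"
  have top: "topspace (Spc K) = Collect (prime_ideal K)"
  proof -
    have "Collect (prime_ideal K) \<subseteq> \<Union>{Collect (prime_ideal K) - Spc_supp K a |a. a \<in> ob K}"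
    proof
      fix P assume P: "P \<in> Collect (prime_ideal K)"
      \<comment> \<open>The basic open set of a zero object is the whole spectrum.\<close>
      obtain Z where Z: "is_zero K Z" using zero_object by blast
      then have "Z \<in> P" using P unfolding prime_ideal_def thick_def by blast
      then have "P \<in> Collect (prime_ideal K) - Spc_supp K Z" using P by (simp add: Spc_supp_def)
      then show "P \<in> \<Union>{Collect (prime_ideal K) - Spc_supp K a |a. a \<in> ob K}"
        using is_zero_ob[OF Z] by blast
    qed
    then show ?thesis unfolding Spc_def topology_generated_by_topspace by blast
  qed
  have zero_sub: "?O \<subseteq> P" if "prime_ideal K P" for P
    using that unfolding prime_ideal_def thick_def by blast
  have basic: "openin (Spc K) (Collect (prime_ideal K) - Spc_supp K a)" if "a \<in> ob K" for a
    unfolding Spc_def using that by (intro topology_generated_by_Basis) blast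
  have "closedin (Spc K) {?O}"
  proof -
    have "topspace (Spc K) - {?O} =
        \<Union>{Collect (prime_ideal K) - Spc_supp K a |a. a \<in> ob K \<and> \<not> is_zero K a}"
      (is "_ = \<Union>?B")
    proof
      show "topspace (Spc K) - {?O} \<subseteq> \<Union>?B"
      proof
        fix P assume P: "P \<in> topspace (Spc K) - {?O}"
        then have pr: "prime_ideal K P" using top by blast
        then obtain a where a: "a \<in> P" "\<not> is_zero K a" using P zero_sub[OF pr] by blast
        then have "a \<in> ob K" using pr unfolding prime_ideal_def thick_def by blast
        moreover have "P \<in> Collect (prime_ideal K) - Spc_supp K a" using a pr by (simp add: Spc_supp_def)
        ultimately show "P \<in> \<Union>?B" using a by blast
      qed
      show "\<Union>?B \<subseteq> topspace (Spc K) - {?O}" using top by (auto simp: Spc_supp_def)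
    qed
    moreover have "openin (Spc K) (\<Union>?B)" using basic by (intro openin_Union) blast
    ultimately show ?thesis using assms top by (simp add: closedin_def)
  qed
  moreover have "x = ?O" if x: "x \<in> topspace (Spc K)" "closedin (Spc K) {x}" for x
  proof (rule ccontr)
    assume n: "x \<noteq> ?O"
    have open_all: "?O \<in> V \<longrightarrow> Collect (prime_ideal K) \<subseteq> V"
      if "generate_topology_on {Collect (prime_ideal K) - Spc_supp K a |a. a \<in> ob K} V" for V
      using that
    proof (induction rule: generate_topology_on.induct)
      case (Basis V)
      then obtain a where V: "V = Collect (prime_ideal K) - Spc_supp K a" by blast
      show ?case
      proof
        assume "?O \<in> V"
        then have "is_zero K a" using V by (simp add: Spc_supp_def)
        then show "Collect (prime_ideal K) \<subseteq> V" using V zero_sub by (auto simp: Spc_supp_def)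
      qed
    qed blast+
    have "openin (Spc K) (topspace (Spc K) - {x})" using x by (simp add: closedin_def)
    then have "generate_topology_on {Collect (prime_ideal K) - Spc_supp K a |a. a \<in> ob K}
        (topspace (Spc K) - {x})"
      unfolding Spc_def openin_topology_generated_by_iff .
    then show False using open_all assms n top x by blast
  qed
  ultimately show ?thesis
    unfolding local_tt_category_def local_space_def using assms top by blast
qed

theorem proposition11p14:
  fixes X :: "'s sset"
    and p :: "'s over_Fin"
    and K :: "('s, 's set) tt_cat"
  assumes "symmetric_monoidal_stable_quasi_category X p"
    and "homotopy_tt_category X p K"
    and "tt_category K"
    and "idempotent_complete K"
    and "connective K"
    and "unigenic K"
    and "local_ring (end_ring K (unit_ob K))"
  shows "local_tt_category K"
proof -
  interpret tt_category K by fact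
  interpret connective_tt K
  proof unfold_locales
    show "unit_ob K \<in> ob K" by (rule unit_ob)
    show "thick_hull K {unit_ob K} = ob K" using assms by (simp add: unigenic_def)
    show "hom0 (unit_ob K) (Sn n (unit_ob K))" if "0 < n" for n
    proof -
      \<comment> \<open>The hypothesis is used at the integer i = -n.\<close>
      have "- int n < 0" using that by simp
      then have "homs K (unit_ob K) (Sn n (unit_ob K)) = {nul K (unit_ob K) (Sn n (unit_ob K))}"
        using assms(5) unfolding connective_def Let_def by (metis minus_minus nat_int)
      then show ?thesis using unit_ob Sn_ob by (simp add: hom0_def)
    qed
  qed
  let ?R = "end_ring K (unit_ob K)"
  have local: "\<exists>k \<in> homs K U U. plus K j k = idn K U \<and> (iso_arr K j \<or> iso_arr K k)"
    if j: "j \<in> homs K U U" for j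
  proof -
    interpret R: cring ?R using assms local_ring_def by blast
    have u: "iso_arr K r" if "r \<in> Units ?R" for r
      using that iso_arr_homs[of r U U] by (auto simp: Units_def end_ring_def)
    have jc: "j \<in> carrier ?R" using j by (simp add: end_ring_def)
    define k where "k = \<one>\<^bsub>?R\<^esub> \<ominus>\<^bsub>?R\<^esub> j"
    have k: "k \<in> carrier ?R" using jc k_def by blast
    have "j \<oplus>\<^bsub>?R\<^esub> k = \<one>\<^bsub>?R\<^esub>" unfolding k_def using jc by algebra
    then have "plus K j k = idn K U" by (simp add: end_ring_def)
    moreover have "k \<in> homs K U U" using k by (simp add: end_ring_def)
    ultimately show ?thesis using local_ring_units[OF assms(7) jc] u k_def by blast
  qed
  \<comment> \<open>Otherwise 1 = 0 in the ring and 1 would lie in its maximal ideal; this makes the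
    zero ideal proper.\<close>
  have "\<not> is_zero K U"
  proof
    assume z: "is_zero K U"
    obtain M where "maximalideal M ?R" using assms local_ring_def by blast
    then interpret M: maximalideal M ?R .
    have "\<one>\<^bsub>?R\<^esub> = \<zero>\<^bsub>?R\<^esub>" using z by (simp add: end_ring_def is_zero_def)
    then have "\<one>\<^bsub>?R\<^esub> \<in> M" by simp
    then show False using M.one_imp_carrier M.I_notcarr by blast
  qed
  then have "{X. is_zero K X} \<noteq> ob K" using U_ob by blast
  then have "prime_ideal K {X. is_zero K X}"
    unfolding prime_ideal_def
    using thick_zero tens_zero_imp[OF local] exact_zero[OF tens_exact_left]
      exact_zero[OF tens_exact_right] by blast
  then show ?thesis by (rule local_if_zero_prime)
qed

end
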